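(* Let $X$ be a Banach space as described in the context, assume that the finite limit $\mu=\lim_{n\to\infty}\|z^n\|^{1/n}>0$ exists, and let $f\in X$, $\rho,\sigma\in(0,\infty)$. If $f$ is (the restriction to $\mathbb{D}$ of) an entire function of finite order $\rho$ and normal type $\sigma$, then $$\limsup_{n\to\infty}\frac{n}{e\rho}\left(\frac{E_n(f)}{\|z^n\|}\right)^{\rho/n}=\sigma .$$ Conversely, if this equality holds, then the sequence $(p_n^* )$ of polynomials of best approximation of $f$ in the norm of $X$ converges uniformly in each disk $|z|<r$, $r\in(0,\mu)$, to some entire function of finite order $\rho$ and normal type $\sigma$.
   Context: $\mathbb{D}=\{z\in\mathbb{C}:|z|<1\}$. Here $X$ is a complex Banach space of functions defined in $\mathbb{D}$ (not necessarily analytic) whose norm $\|\cdot\|$ satisfies: (i) $\|f(\cdot\, e^{it})\|=\|f(\cdot)\|$ for all $t\in\mathbb{R}$ and $f\in X$; (ii) $\|f\|<\infty$ for every entire function $f$; (iii) for all $f\in X$ and $g\in L[0,2\pi]$, $\big\|\frac{1}{2\pi}\int_0^{2\pi} f(ze^{it})g(t)\,dt\big\|\le \frac{1}{2\pi}\int_0^{2\pi}|g(t)|\,dt\cdot\|f\|$. For $n\ge 1$, $\mathcal{P}_n$ is the set of complex polynomials of degree at most $n-1$, $E_n(f)=\inf_{p\in\mathcal{P}_n}\|f-p\|$, $p_n^*\in\mathcal{P}_n$ is a polynomial with $\|f-p_n^*\|=E_n(f)$, and $\|z^n\|$ is the norm in $X$ of $z\mapsto z^n$. For an entire $F$ with $M(r)=\max_{|z|=r}|F(z)|$: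 order $\rho=\limsup_{r\to\infty}\frac{\ln\ln M(r)}{\ln r}$, type $\limsup_{r\to\infty}\frac{\ln M(r)}{r^\rho}$; normal type means the type lies in $(0,\infty)$. *)

theory Defs
  imports "HOL-Analysis.Analysis" "HOL-Library.Liminf_Limsup"
begin

text \<open>Elements of X are modelled as functions complex => complex, of which only
  the values in the unit disc matter; N is the norm of X.\<close>

definition udisc :: "complex set" where "udisc = ball 0 1"

definition fun_banach_space ::
  "(complex \<Rightarrow> complex) set \<Rightarrow> ((complex \<Rightarrow> complex) \<Rightarrow> real) \<Rightarrow> bool" where
  "fun_banach_space X N \<longleftrightarrow>
     \<comment> \<open>functions defined in the disc: only values in D matter\<close>
     (\<forall>f g. f \<in> X \<longrightarrow> (\<forall>z\<in>udisc. g z = f z) \<longrightarrow> g \<in> X \<and> N g = N f) \<and>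
     \<comment> \<open>complex linear space\<close>
     (\<lambda>z. 0) \<in> X \<and>
     (\<forall>f\<in>X. \<forall>g\<in>X. (\<lambda>z. f z + g z) \<in> X) \<and>
     (\<forall>f\<in>X. \<forall>c::complex. (\<lambda>z. c * f z) \<in> X) \<and>
     \<comment> \<open>norm axioms\<close>
     (\<forall>f\<in>X. N f \<ge> 0) \<and>
     (\<forall>f\<in>X. N f = 0 \<longleftrightarrow> (\<forall>z\<in>udisc. f z = 0)) \<and>
     (\<forall>f\<in>X. \<forall>c::complex. N (\<lambda>z. c * f z) = norm c * N f) \<and>
     (\<forall>f\<in>X. \<forall>g\<in>X. N (\<lambda>z. f z + g z) \<le> N f + N g) \<and>
     \<comment> \<open>completeness\<close>
     (\<forall>s::nat \<Rightarrow> complex \<Rightarrow> complex. (\<forall>n. s n \<in> X) \<longrightarrow>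
        (\<forall>e>0. \<exists>M. \<forall>m\<ge>M. \<forall>n\<ge>M. N (\<lambda>z. s m z - s n z) < e) \<longrightarrow>
        (\<exists>g\<in>X. (\<lambda>n. N (\<lambda>z. s n z - g z)) \<longlonglongrightarrow> 0))"

definition admissible_space ::
  "(complex \<Rightarrow> complex) set \<Rightarrow> ((complex \<Rightarrow> complex) \<Rightarrow> real) \<Rightarrow> bool" where
  "admissible_space X N \<longleftrightarrow>
     fun_banach_space X N \<and>
     \<comment> \<open>(i) rotation invariance\<close>
     (\<forall>f\<in>X. \<forall>t::real. (\<lambda>z. f (z * cis t)) \<in> X \<and> N (\<lambda>z. f (z * cis t)) = N f) \<and>
     \<comment> \<open>(ii) every entire function belongs to X (has finite norm)\<close>
     (\<forall>f. f holomorphic_on UNIV \<longrightarrow> f \<in> X) \<and>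
     \<comment> \<open>(iii) convolution with L^1 kernels\<close>
     (\<forall>f\<in>X. \<forall>g::real \<Rightarrow> complex. g absolutely_integrable_on {0..2*pi} \<longrightarrow>
        (\<lambda>z. integral {0..2*pi} (\<lambda>t. f (z * cis t) * g t) / (2*pi)) \<in> X \<and>
        N (\<lambda>z. integral {0..2*pi} (\<lambda>t. f (z * cis t) * g t) / (2*pi))
          \<le> integral {0..2*pi} (\<lambda>t. norm (g t)) / (2*pi) * N f)"

definition polys :: "nat \<Rightarrow> (complex \<Rightarrow> complex) set" where
  "polys n = {p. \<exists>c::nat \<Rightarrow> complex. p = (\<lambda>z. \<Sum>k<n. c k * z ^ k)}"

definition best_approx_err ::
  "((complex \<Rightarrow> complex) \<Rightarrow> real) \<Rightarrow> nat \<Rightarrow> (complex \<Rightarrow> complex) \<Rightarrow> real" where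
  "best_approx_err N n f = (INF p\<in>polys n. N (\<lambda>z. f z - p z))"

definition max_modulus :: "(complex \<Rightarrow> complex) \<Rightarrow> real \<Rightarrow> real" where
  "max_modulus F r = Sup ((\<lambda>z. norm (F z)) ` sphere 0 r)"

definition entire_order_type :: "(complex \<Rightarrow> complex) \<Rightarrow> real \<Rightarrow> real \<Rightarrow> bool" where
  "entire_order_type F \<rho> \<sigma> \<longleftrightarrow>
     F holomorphic_on UNIV \<and>
     Limsup at_top (\<lambda>r. ereal (ln (ln (max_modulus F r)) / ln r)) = ereal \<rho> \<and>
     Limsup at_top (\<lambda>r. ereal (ln (max_modulus F r) / r powr \<rho>)) = ereal \<sigma>"

end

theory Submission
  imports Defs "HOL-Complex_Analysis.Complex_Analysis" "HOL-Real_Asymp.Real_Asymp"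
begin

text \<open>
  Let \<open>F\<close> be entire with Taylor coefficients \<open>a n\<close>. Convolution with \<open>cis (- n * t)\<close> extracts the term
  \<open>a n * z ^ n\<close> and annihilates polynomials of degree below \<open>n\<close>, while the Taylor sums of \<open>F\<close> converge to
  \<open>F\<close> in \<open>X\<close>; hence, with \<open>w n\<close> the norm of \<open>z ^ n\<close>,
  \<open>norm (a n) * w n \<le> E n \<le> (\<Sum>k\<ge>n. norm (a k) * w k)\<close>.
  Since \<open>w n\<close> has a positive root limit and \<open>a n\<close> decays superexponentially, the tail has the same
  growth as its first term, so \<open>E n / w n\<close> and \<open>norm (a n)\<close> have the same limit superior, which by the classical
  coefficient formula is the type. Conversely, if \<open>E n\<close> decays this fast, the coefficients of the best
  approximants converge to some \<open>a k\<close> with error at most \<open>E n / w k\<close>, and the entire function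
  \<open>\<Sum>k. a k * z ^ k\<close> coincides with \<open>f\<close> on the disc.
\<close>

section \<open>Comparison of limits superior\<close>

text \<open>A limit superior is at most \<open>c\<close> once every level above \<open>c\<close> is
  eventually respected. The gap between \<open>s\<close> and \<open>s'\<close> leaves room for
  estimates that lose an arbitrarily small factor, and two filters occur because radii will be
  compared with indices.\<close>

lemma Limsup_transfer_le:
  fixes u :: "'a \<Rightarrow> real" and v :: "'b \<Rightarrow> real"
  assumes uv: "\<And>s s'. 0 < s \<Longrightarrow> s < s' \<Longrightarrow> (\<forall>\<^sub>F x in F. u x \<le> s) \<Longrightarrow> (\<forall>\<^sub>F y in G. v y \<le> s')"
    and c: "0 \<le> c" and u: "Limsup F (\<lambda>x. ereal (u x)) \<le> ereal c"
  shows "Limsup G (\<lambda>y. ereal (v y)) \<le> ereal c"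
proof (rule ereal_le_epsilon2)
  fix e :: real assume e: "0 < e"
  have "\<forall>\<^sub>F x in F. ereal (u x) < ereal (c + e / 2)"
    using u e by (intro Limsup_lessD order.strict_trans1[OF u]) simp
  then have "\<forall>\<^sub>F x in F. u x \<le> c + e / 2"
    by (rule eventually_mono) simp
  then have "\<forall>\<^sub>F y in G. v y \<le> c + e"
    using c e by (intro uv[of "c + e / 2" "c + e"]) auto
  then have "Limsup G (\<lambda>y. ereal (v y)) \<le> ereal (c + e)"
    by (intro Limsup_bounded) simp
  then show "Limsup G (\<lambda>y. ereal (v y)) \<le> ereal c + ereal e" by simp
qed

text \<open>By contraposition: a smaller limit superior of \<open>v\<close> would leave room for a
  level \<open>d\<close> below \<open>c\<close>, and transferring the bound \<open>d\<close> back to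
  \<open>u\<close> contradicts the hypothesis.\<close>

lemma Limsup_transfer_ge:
  fixes u :: "'a \<Rightarrow> real" and v :: "'b \<Rightarrow> real"
  assumes vu: "\<And>s s'. 0 < s \<Longrightarrow> s < s' \<Longrightarrow> (\<forall>\<^sub>F y in G. v y \<le> s) \<Longrightarrow> (\<forall>\<^sub>F x in F. u x \<le> s')"
    and c: "0 < c" and u: "ereal c \<le> Limsup F (\<lambda>x. ereal (u x))"
  shows "ereal c \<le> Limsup G (\<lambda>y. ereal (v y))"
proof (rule ccontr)
  assume "\<not> ?thesis"
  \<comment> \<open>The maximum with 0 forces \<open>d\<close> to be positive, since bounds are
    transferred only at positive levels.\<close>
  then have "max 0 (Limsup G (\<lambda>y. ereal (v y))) < ereal c" using c by (simp add: zero_ereal_def)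
  then obtain d where d: "max 0 (Limsup G (\<lambda>y. ereal (v y))) < ereal d" "ereal d < ereal c"
    using ereal_dense2 by blast
  then have "0 < d" by (auto simp: zero_ereal_def)
  moreover have "Limsup G (\<lambda>y. ereal (v y)) \<le> ereal d" using d by (simp add: less_imp_le)
  ultimately have "Limsup F (\<lambda>x. ereal (u x)) \<le> ereal d"
    by (intro Limsup_transfer_le[where F = G and u = v, OF vu]) auto
  then show False using order_trans[OF u] d by fastforce
qed

lemma Limsup_transfer_iff:
  fixes u :: "'a \<Rightarrow> real" and v :: "'b \<Rightarrow> real"
  assumes uv: "\<And>s s'. 0 < s \<Longrightarrow> s < s' \<Longrightarrow> (\<forall>\<^sub>F x in F. u x \<le> s) \<Longrightarrow> (\<forall>\<^sub>F y in G. v y \<le> s')"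
    and vu: "\<And>s s'. 0 < s \<Longrightarrow> s < s' \<Longrightarrow> (\<forall>\<^sub>F y in G. v y \<le> s) \<Longrightarrow> (\<forall>\<^sub>F x in F. u x \<le> s')"
    and c: "0 < c"
  shows "Limsup F (\<lambda>x. ereal (u x)) = ereal c \<longleftrightarrow> Limsup G (\<lambda>y. ereal (v y)) = ereal c"
proof
  assume eq: "Limsup F (\<lambda>x. ereal (u x)) = ereal c"
  show "Limsup G (\<lambda>y. ereal (v y)) = ereal c"
  proof (rule antisym)
    show "Limsup G (\<lambda>y. ereal (v y)) \<le> ereal c"
      by (rule Limsup_transfer_le[where F = F and u = u]) (fact uv, use c eq in simp_all)
    show "ereal c \<le> Limsup G (\<lambda>y. ereal (v y))"
      by (rule Limsup_transfer_ge[where F = F and u = u]) (fact vu, use c eq in simp_all)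
  qed
next
  assume eq: "Limsup G (\<lambda>y. ereal (v y)) = ereal c"
  show "Limsup F (\<lambda>x. ereal (u x)) = ereal c"
  proof (rule antisym)
    show "Limsup F (\<lambda>y. ereal (u y)) \<le> ereal c"
      by (rule Limsup_transfer_le[where F = G and u = v]) (fact vu, use c eq in simp_all)
    show "ereal c \<le> Limsup F (\<lambda>y. ereal (u y))"
      by (rule Limsup_transfer_ge[where F = G and u = v]) (fact uv, use c eq in simp_all)
  qed
qed

section \<open>Superexponential coefficient bounds and tails of series\<close>

lemma powr_nat_div_eq:
  fixes b \<rho> :: real
  assumes "n \<ge> 1"
  shows "b powr (real n / \<rho>) = (b powr (1 / \<rho>)) ^ n"
  using assms by (cases "b = 0") (simp_all add: powr_power)

text \<open>Raising to the power n / \<rho> turns a level of the limit superior into an explicit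
  superexponential bound. All growth estimates below are made in this second form.\<close>

lemma growth_le_iff:
  fixes \<rho> s x :: real
  assumes "n \<ge> 1" "x \<ge> 0" "s > 0" "\<rho> > 0"
  shows "real n / (exp 1 * \<rho>) * x powr (\<rho> / real n) \<le> s \<longleftrightarrow>
         x \<le> (exp 1 * \<rho> * s / real n) powr (real n / \<rho>)"
proof -
  let ?b = "exp 1 * \<rho> * s / real n"
  have b: "?b > 0" using assms by simp
  have "real n / (exp 1 * \<rho>) * x powr (\<rho> / real n) \<le> s \<longleftrightarrow> x powr (\<rho> / real n) \<le> ?b"
    using assms by (simp add: field_simps)
  also have "?b = (?b powr (real n / \<rho>)) powr (\<rho> / real n)"
    using assms b by (simp add: powr_powr)
  also have "x powr (\<rho> / real n) \<le> \<dots> \<longleftrightarrow> x \<le> ?b powr (real n / \<rho>)"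
    using assms b by (smt (verit, best) divide_pos_pos of_nat_0_less_iff powr_ge_zero powr_less_mono2 powr_mono2
        not_one_le_zero not_gr_zero le_zero_eq)
  finally show ?thesis .
qed

lemma eventually_power_root_small:
  fixes C \<rho> R \<epsilon> :: real
  assumes "C > 0" "\<rho> > 0" "\<epsilon> > 0"
  shows "\<forall>\<^sub>F n in sequentially. (C / real n) powr (1 / \<rho>) * R \<le> \<epsilon>"
proof -
  have "(\<lambda>n. (C / real n) powr (1 / \<rho>) * R) \<longlonglongrightarrow> 0"
    using assms by real_asymp
  from order_tendstoD(2)[OF this \<open>\<epsilon> > 0\<close>] show ?thesis
    by (rule eventually_mono) simp
qed

text \<open>The n-th root of the bound, multiplied by any fixed \<open>R\<close>, tends to 0; so
  \<open>a\<close> decays faster than every geometric sequence.\<close>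

lemma eventually_supergeometric:
  fixes a :: "nat \<Rightarrow> real" and C \<rho> R \<epsilon> :: real
  assumes "C > 0" "\<rho> > 0" "\<epsilon> > 0" "R \<ge> 0"
    and a: "\<forall>\<^sub>F n in sequentially. a n \<le> (C / real n) powr (real n / \<rho>)"
  shows "\<forall>\<^sub>F n in sequentially. a n * R ^ n \<le> \<epsilon> ^ n"
  using a eventually_power_root_small[OF assms(1-3), of R] eventually_ge_at_top[of 1]
proof eventually_elim
  case (elim n)
  have "a n * R ^ n \<le> (C / real n) powr (real n / \<rho>) * R ^ n"
    using elim assms by (intro mult_right_mono) auto
  also have "\<dots> = ((C / real n) powr (1 / \<rho>) * R) ^ n"
    using elim by (simp add: powr_nat_div_eq power_mult_distrib)
  also have "\<dots> \<le> \<epsilon> ^ n"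
    using elim assms by (intro power_mono) auto
  finally show ?case .
qed

lemma summable_supergeometric:
  fixes a :: "nat \<Rightarrow> real" and C \<rho> R :: real
  assumes "C > 0" "\<rho> > 0" "R \<ge> 0" "\<And>n. a n \<ge> 0"
    and a: "\<forall>\<^sub>F n in sequentially. a n \<le> (C / real n) powr (real n / \<rho>)"
  shows "summable (\<lambda>n. a n * R ^ n)"
proof (rule summable_comparison_test_ev)
  show "\<forall>\<^sub>F n in sequentially. norm (a n * R ^ n) \<le> (1 / 2) ^ n"
    using eventually_supergeometric[OF assms(1,2) _ assms(3) a, of "1/2"] assms by simp
qed simp

text \<open>From index \<open>n\<close> on the terms \<open>a k * w k\<close> lie below
  \<open>x ^ k\<close> with a ratio \<open>x\<close> of at most 1/2, so the tail is at most
  \<open>2 * x ^ n\<close>. Replacing the upper root bound on \<open>w\<close> by the lower one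
  costs \<open>\<kappa> ^ n\<close>. After taking the power \<rho> / n the factor 2 disappears in
  the limit and \<kappa> contributes only \<open>\<kappa> powr \<rho>\<close>, which is close to
  1.\<close>

lemma growth_tail_transfer:
  fixes a w e :: "nat \<Rightarrow> real"
  assumes w: "\<And>n. w n > 0" and lim: "(\<lambda>n. w n powr (1 / real n)) \<longlonglongrightarrow> \<mu>" and "\<mu> > 0"
    and a: "\<And>n. a n \<ge> 0" and "\<rho> > 0" and s: "0 < s" "s < s'"
    and ev: "\<forall>\<^sub>F n in sequentially. a n \<le> (exp 1 * \<rho> * s / real n) powr (real n / \<rho>)"
    and e: "\<And>n. summable (\<lambda>k. a k * w k) \<Longrightarrow> e n \<le> (\<Sum>k. a (k + n) * w (k + n))" and e0: "\<And>n. e n \<ge> 0"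
  shows "\<forall>\<^sub>F n in sequentially. real n / (exp 1 * \<rho>) * (e n / w n) powr (\<rho> / real n) \<le> s'"
proof -
  define C where "C = exp 1 * \<rho> * s"
  have C: "C > 0" using assms by (simp add: C_def)
  \<comment> \<open>The root bounds \<mu> - \<epsilon> and \<mu> + \<epsilon> on \<open>w\<close>
    must be close enough for their quotient, raised to \<rho>, to fit between \<open>s\<close> and
    \<open>s'\<close>.\<close>
  have "((\<lambda>\<epsilon>. ((\<mu> + \<epsilon>) / (\<mu> - \<epsilon>)) powr \<rho> * s) \<longlongrightarrow> ((\<mu> + 0) / (\<mu> - 0)) powr \<rho> * s) (at_right 0)"
    using \<open>\<mu> > 0\<close> by (intro tendsto_intros) auto
  then have "\<forall>\<^sub>F \<epsilon> in at_right 0. ((\<mu> + \<epsilon>) / (\<mu> - \<epsilon>)) powr \<rho> * s < s'"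
    using s \<open>\<mu> > 0\<close> by (intro order_tendstoD) auto
  moreover have "\<forall>\<^sub>F \<epsilon> in at_right 0. \<epsilon> \<in> {0<..<\<mu>}"
    using \<open>\<mu> > 0\<close> by (rule eventually_at_right_real)
  ultimately have "\<exists>\<epsilon>. ((\<mu> + \<epsilon>) / (\<mu> - \<epsilon>)) powr \<rho> * s < s' \<and> \<epsilon> \<in> {0<..<\<mu>}"
    by (intro eventually_happens'[OF trivial_limit_at_right_real] eventually_conj)
  then obtain \<epsilon> where \<epsilon>: "0 < \<epsilon>" "\<epsilon> < \<mu>" "((\<mu> + \<epsilon>) / (\<mu> - \<epsilon>)) powr \<rho> * s < s'"
    by auto
  define \<kappa> where "\<kappa> = (\<mu> + \<epsilon>) / (\<mu> - \<epsilon>)"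
  have \<kappa>: "\<kappa> > 0" "\<kappa> powr \<rho> * s < s'" using \<epsilon> \<open>\<mu> > 0\<close> by (auto simp: \<kappa>_def)
  have w_ev: "\<forall>\<^sub>F n in sequentially. (\<mu> - \<epsilon>) ^ n \<le> w n \<and> w n \<le> (\<mu> + \<epsilon>) ^ n"
    using order_tendstoD(1)[OF lim, of "\<mu> - \<epsilon>", simplified, OF \<epsilon>(1)]
      order_tendstoD(2)[OF lim, of "\<mu> + \<epsilon>", simplified, OF \<epsilon>(1)] eventually_ge_at_top[of 1]
  proof eventually_elim
    case (elim n)
    have "w n = (w n powr (1 / real n)) ^ n" using w[of n] elim by (simp add: powr_power)
    then show ?case using elim \<epsilon>
      by (metis diff_gt_0_iff_gt less_eq_real_def power_mono powr_ge_zero)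
  qed
  have "((\<lambda>n. 2 powr (\<rho> / real n) * (\<kappa> powr \<rho> * s)) \<longlonglongrightarrow> 2 powr 0 * (\<kappa> powr \<rho> * s))"
    by (intro tendsto_intros) (real_asymp | simp)+
  then have two_ev: "\<forall>\<^sub>F n in sequentially. 2 powr (\<rho> / real n) * (\<kappa> powr \<rho> * s) < s'"
    using \<kappa> by (intro order_tendstoD) auto
  obtain n0 where n0: "\<And>k. k \<ge> n0 \<Longrightarrow> a k \<le> (C / real k) powr (real k / \<rho>)"
      "\<And>k. k \<ge> n0 \<Longrightarrow> (\<mu> - \<epsilon>) ^ k \<le> w k \<and> w k \<le> (\<mu> + \<epsilon>) ^ k"
    using eventually_conj[OF ev w_ev] unfolding eventually_sequentially C_def by blast
  show ?thesis
    using two_ev eventually_ge_at_top[of n0] eventually_ge_at_top[of 1]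
      eventually_power_root_small[OF C \<open>\<rho> > 0\<close>, of "1/2" "\<mu> + \<epsilon>", simplified]
  proof eventually_elim
    case (elim n)
    \<comment> \<open>The ratio is taken at the first index \<open>n\<close> of the tail:
      \<open>(C / k) powr (1 / \<rho>)\<close> decreases in \<open>k\<close>, so the same
      \<open>x\<close> serves for all later terms.\<close>
    define x where "x = (C / real n) powr (1 / \<rho>) * (\<mu> + \<epsilon>)"
    have x: "0 < x" "x \<le> 1/2" using elim \<epsilon> C \<open>\<mu> > 0\<close> by (auto simp: x_def)
    have term_le: "a k * w k \<le> x ^ k" if "k \<ge> n" for k
    proof -
      have "k \<ge> 1" "k \<ge> n0" using that elim by auto
      then have "a k * w k \<le> (C / real k) powr (real k / \<rho>) * (\<mu> + \<epsilon>) ^ k"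
        using n0[of k] a[of k] w[of k] by (intro mult_mono) auto
      also have "\<dots> = ((C / real k) powr (1 / \<rho>) * (\<mu> + \<epsilon>)) ^ k"
        using \<open>k \<ge> 1\<close> by (simp add: powr_nat_div_eq power_mult_distrib)
      also have "\<dots> \<le> x ^ k"
        unfolding x_def using \<epsilon> that elim C \<open>\<rho> > 0\<close> \<open>\<mu> > 0\<close>
        by (intro power_mono mult_right_mono powr_mono2 divide_left_mono) auto
      finally show ?thesis .
    qed
    have sumx: "summable (\<lambda>k. x ^ k)" using x by (intro summable_geometric) auto
    have sum_aw: "summable (\<lambda>k. a k * w k)"
      using term_le a less_imp_le[OF w]
      by (intro summable_comparison_test_ev[OF _ sumx]) (auto simp: eventually_sequentially intro!: exI[of _ n])
    have "e n \<le> (\<Sum>k. a (k + n) * w (k + n))" using e sum_aw by blast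
    also have "\<dots> \<le> (\<Sum>k. x ^ n * x ^ k)"
    proof (rule suminf_le)
      show "a (k + n) * w (k + n) \<le> x ^ n * x ^ k" for k
        using term_le[of "k + n"] by (simp add: power_add mult.commute)
      show "summable (\<lambda>k. a (k + n) * w (k + n))"
        using sum_aw by (subst summable_iff_shift)
      show "summable (\<lambda>k. x ^ n * x ^ k)" using sumx by (rule summable_mult)
    qed
    also have "\<dots> = x ^ n * (1 / (1 - x))"
      using x sumx by (simp add: suminf_mult suminf_geometric)
    also have "\<dots> \<le> x ^ n * 2"
      using x by (intro mult_left_mono) (auto simp: field_simps)
    finally have en: "e n \<le> 2 * x ^ n" by simp
    have "e n / w n \<le> 2 * x ^ n / (\<mu> - \<epsilon>) ^ n"
      using en e0[of n] n0(2)[of n] elim \<epsilon> by (intro frac_le) auto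
    also have "\<dots> = 2 * (\<kappa> * (C / real n) powr (1 / \<rho>)) ^ n"
      by (simp add: x_def \<kappa>_def power_mult_distrib power_divide field_simps)
    finally have "(e n / w n) powr (\<rho> / real n) \<le> (2 * (\<kappa> * (C / real n) powr (1 / \<rho>)) ^ n) powr (\<rho> / real n)"
      using e0[of n] w[of n] \<open>\<rho> > 0\<close> by (intro powr_mono2) auto
    also have "\<dots> = 2 powr (\<rho> / real n) * (\<kappa> * (C / real n) powr (1 / \<rho>)) powr \<rho>"
      using \<kappa> C elim by (simp add: powr_mult powr_powr flip: powr_realpow)
    also have "\<dots> = 2 powr (\<rho> / real n) * (\<kappa> powr \<rho> * (C / real n))"
      using \<kappa> C elim \<open>\<rho> > 0\<close> by (simp add: powr_mult powr_powr)
    finally have "real n / (exp 1 * \<rho>) * (e n / w n) powr (\<rho> / real n) \<le>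
        real n / (exp 1 * \<rho>) * (2 powr (\<rho> / real n) * (\<kappa> powr \<rho> * (C / real n)))"
      using \<open>\<rho> > 0\<close> by (intro mult_left_mono) auto
    also have "\<dots> = 2 powr (\<rho> / real n) * (\<kappa> powr \<rho> * s)"
      using elim \<open>\<rho> > 0\<close> by (simp add: C_def field_simps)
    finally show ?case using elim by linarith
  qed
qed

section \<open>Convolutions of power series\<close>

lemma integral_series:
  fixes \<phi> :: "nat \<Rightarrow> real \<Rightarrow> complex"
  assumes cont: "\<And>k. continuous_on {a..b::real} (\<phi> k)"
    and le: "\<And>k t. t \<in> {a..b} \<Longrightarrow> norm (\<phi> k t) \<le> B k" and B: "summable B"
    and sums: "\<And>t. t \<in> {a..b} \<Longrightarrow> (\<lambda>k. \<phi> k t) sums h t"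
  shows "(\<lambda>k. integral {a..b} (\<phi> k)) sums integral {a..b} h"
proof -
  have "uniform_limit {a..b} (\<lambda>n t. \<Sum>k<n. \<phi> k t) (\<lambda>t. suminf (\<lambda>k. \<phi> k t)) sequentially"
    using le B by (intro Weierstrass_m_test) auto
  then have "uniform_limit {a..b} (\<lambda>n t. \<Sum>k<n. \<phi> k t) h sequentially"
    using sums by (subst uniform_limit_cong'[where g = "\<lambda>n t. \<Sum>k<n. \<phi> k t"]) (auto simp: sums_iff)
  moreover have "continuous_on {a..b} (\<lambda>t. \<Sum>k<n. \<phi> k t)" for n
    by (intro continuous_on_sum cont)
  ultimately obtain I J where IJ: "\<And>n. ((\<lambda>t. \<Sum>k<n. \<phi> k t) has_integral I n) {a..b}"
      "(h has_integral J) {a..b}" "I \<longlonglongrightarrow> J"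
    by (rule uniform_limit_integral) (auto intro: that)
  moreover have "I = (\<lambda>n. \<Sum>k<n. integral {a..b} (\<phi> k))"
    using integral_unique[OF IJ(1)] cont
    by (simp add: integral_sum integrable_continuous_real fun_eq_iff)
  ultimately show ?thesis unfolding sums_def by (simp add: integral_unique)
qed

lemma integral_cis_mult:
  fixes j n :: nat
  shows "integral {0..2*pi} (\<lambda>t. cis (real j * t) * cis (- (real n * t))) = (if j = n then 2 * pi else 0)"
proof (cases "j = n")
  case True
  then show ?thesis by (simp add: cis_mult scaleR_conv_of_real)
next
  case False
  \<comment> \<open>The difference of frequencies may be negative, so it is formed in the
    integers.\<close>
  define m where "m = real_of_int (int j - int n)"
  have m: "m \<noteq> 0" using False by (simp add: m_def)
  have eq: "cis (real j * t) * cis (- (real n * t)) = cis (m * t)" for t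
    by (simp add: cis_mult m_def algebra_simps)
  have "((\<lambda>t. cis (m * t)) has_integral (cis (m * (2*pi)) / (\<i> * m) - cis (m * 0) / (\<i> * m))) {0..2*pi}"
  proof (rule fundamental_theorem_of_calculus)
    fix t assume "t \<in> {0..2*pi}"
    have "((\<lambda>t. exp (\<i> * of_real m * of_real t) / (\<i> * m)) has_vector_derivative exp (\<i> * m * t)) (at t within {0..2*pi})"
      using m by (auto intro!: derivative_eq_intros has_vector_derivative_real_field)
    then show "((\<lambda>t. cis (m * t) / (\<i> * m)) has_vector_derivative cis (m * t)) (at t within {0..2*pi})"
      by (simp add: cis_conv_exp mult.assoc)
  qed simp
  moreover have "cis (m * (2*pi)) = 1"
    unfolding m_def using cis_multiple_2pi[of "real_of_int (int j - int n)"]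
    by (simp add: mult.commute mult.left_commute)
  ultimately show ?thesis using False unfolding eq by (simp add: integral_unique)
qed

text \<open>Convergence at a point of modulus \<open>norm z + 1\<close> gives absolute convergence
  at \<open>z\<close>.\<close>

lemma power_series_abs_summable:
  fixes a :: "nat \<Rightarrow> complex"
  assumes "\<And>z. (\<lambda>k. a k * z ^ k) sums F z"
  shows "summable (\<lambda>k. norm (a k) * norm (z::complex) ^ k)"
  using powser_insidea[of a "of_real (norm z + 1)" z] assms
  by (simp add: sums_iff norm_mult norm_power)

text \<open>Rotating the argument by \<open>cis t\<close> multiplies the k-th term by
  \<open>cis (k * t)\<close>; convolution with \<open>g\<close> therefore acts on the coefficients
  as a Fourier multiplier. Absolute convergence on the circle permits integration term by
  term.\<close>

lemma convolution_power_series: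
  fixes a :: "nat \<Rightarrow> complex" and g :: "real \<Rightarrow> complex"
  assumes F: "\<And>z. (\<lambda>k. a k * z ^ k) sums F z" and g: "continuous_on {0..2*pi} g"
  shows "(\<lambda>k. a k * z ^ k * integral {0..2*pi} (\<lambda>t. cis (real k * t) * g t)) sums
           integral {0..2*pi} (\<lambda>t. F (z * cis t) * g t)"
proof -
  obtain B where B: "\<And>t. t \<in> {0..2*pi} \<Longrightarrow> norm (g t) \<le> B"
    using compact_imp_bounded[OF compact_continuous_image[OF g compact_Icc]]
    unfolding bounded_iff by (metis imageI)
  have "(\<lambda>k. integral {0..2*pi} (\<lambda>t. a k * (z * cis t) ^ k * g t)) sums
          integral {0..2*pi} (\<lambda>t. F (z * cis t) * g t)"
  proof (rule integral_series)
    show "continuous_on {0..2*pi} (\<lambda>t. a k * (z * cis t) ^ k * g t)" for k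
      by (intro continuous_intros g)
    show "norm (a k * (z * cis t) ^ k * g t) \<le> norm (a k) * norm z ^ k * B" if "t \<in> {0..2*pi}" for k t
      using B[OF that] by (auto simp: norm_mult norm_power intro!: mult_left_mono)
    show "summable (\<lambda>k. norm (a k) * norm z ^ k * B)"
      by (intro summable_mult2 power_series_abs_summable[OF F])
    show "(\<lambda>k. a k * (z * cis t) ^ k * g t) sums (F (z * cis t) * g t)" for t
      by (intro sums_mult2 F)
  qed
  moreover have "(\<lambda>t. a k * (z * cis t) ^ k * g t) = (\<lambda>t. a k * z ^ k * (cis (real k * t) * g t))" for k
    by (simp add: power_mult_distrib Complex.DeMoivre mult_ac)
  ultimately show ?thesis by simp
qed

lemma fourier_coefficient_power_series:
  fixes a :: "nat \<Rightarrow> complex"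
  assumes F: "\<And>z. (\<lambda>k. a k * z ^ k) sums F z"
  shows "integral {0..2*pi} (\<lambda>t. F (z * cis t) * cis (- (real n * t))) / (2*pi) = a n * z ^ n"
proof -
  have "(\<lambda>k. a k * z ^ k * (if k = n then 2 * pi else 0)) sums
          integral {0..2*pi} (\<lambda>t. F (z * cis t) * cis (- (real n * t)))"
    using convolution_power_series[OF F, of "\<lambda>t. cis (- (real n * t))" z]
    unfolding integral_cis_mult by (simp add: continuous_intros)
  moreover have "(\<lambda>k. a k * z ^ k * (if k = n then 2 * pi else 0)) sums (a n * z ^ n * (2 * pi))"
    using sums_single[of n "\<lambda>k. a k * z ^ k * (2 * pi)"] by (simp add: if_distrib cong: if_cong)
  ultimately have "integral {0..2*pi} (\<lambda>t. F (z * cis t) * cis (- (real n * t))) = a n * z ^ n * (2 * pi)"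
    by (rule sums_unique2)
  then show ?thesis by simp
qed

text \<open>
  The kernel is the geometric tail \<open>\<Sum>k\<ge>n. (cis (- t) / 2) ^ k\<close>. Convolving it with the dilation
  \<open>z \<mapsto> F (2 * z)\<close>, whose coefficients are \<open>2 ^ k * a k\<close>, reproduces the Taylor remainder of \<open>F\<close>; as the
  kernel is small in \<open>L\<^sup>1\<close>, Taylor sums of entire functions converge in any admissible norm.
\<close>
definition tail_kernel :: "nat \<Rightarrow> real \<Rightarrow> complex" where
  "tail_kernel n t = (cis (- t) / 2) ^ n / (1 - cis (- t) / 2)"

lemma norm_half_cis_less: "norm (cis (- t) / 2) < 1"
  by (simp add: norm_divide)

lemma tail_kernel_denom_nonzero: "1 - cis (- t) / 2 \<noteq> 0"
  using norm_half_cis_less[of t] by (metis norm_one order_less_irrefl right_minus_eq)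

lemma continuous_on_tail_kernel: "continuous_on A (tail_kernel n)"
  unfolding tail_kernel_def using tail_kernel_denom_nonzero by (intro continuous_intros) auto

lemma norm_tail_kernel_le: "norm (tail_kernel n t) \<le> 2 * (1 / 2) ^ n"
proof -
  have "norm (1 - cis (- t) / 2) \<ge> norm (1::complex) - norm (cis (- t) / 2)"
    by (rule norm_triangle_ineq2)
  then have "norm (1 - cis (- t) / 2) \<ge> 1 / 2" by (simp add: norm_divide)
  then have "(1 / 2) ^ n / norm (1 - cis (- t) / 2) \<le> (1 / 2) ^ n / (1 / 2 :: real)"
    by (intro divide_left_mono) auto
  then show ?thesis by (simp add: tail_kernel_def norm_divide norm_power mult.commute)
qed

text \<open>With the kernel expanded as a geometric series, orthogonality leaves only the term of
  exponent \<open>j\<close>, of weight \<open>1 / 2 ^ j\<close>. The series starts at exponent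
  \<open>n\<close>, so smaller \<open>j\<close> find no partner.\<close>

lemma integral_tail_kernel:
  "integral {0..2*pi} (\<lambda>t. cis (real j * t) * tail_kernel n t) = (if n \<le> j then 2 * pi / 2 ^ j else 0)"
proof -
  have "(\<lambda>k. integral {0..2*pi} (\<lambda>t. cis (real j * t) * (cis (- t) / 2) ^ (k + n))) sums
          integral {0..2*pi} (\<lambda>t. cis (real j * t) * tail_kernel n t)"
  proof (rule integral_series)
    show "continuous_on {0..2*pi} (\<lambda>t. cis (real j * t) * (cis (- t) / 2) ^ (k + n))" for k
      by (intro continuous_intros) auto
    show "norm (cis (real j * t) * (cis (- t) / 2) ^ (k + n)) \<le> (1 / 2) ^ (k + n)" for k t
      by (simp add: norm_mult norm_power norm_divide)
    show "summable (\<lambda>k. (1 / 2) ^ (k + n) :: real)"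
      by (subst summable_iff_shift) (simp add: summable_geometric)
    show "(\<lambda>k. cis (real j * t) * (cis (- t) / 2) ^ (k + n)) sums (cis (real j * t) * tail_kernel n t)" for t
      using sums_mult[OF geometric_sums[OF norm_half_cis_less[of t]], of "(cis (- t) / 2) ^ n"]
      by (intro sums_mult) (simp add: tail_kernel_def power_add mult.commute)
  qed
  moreover have "integral {0..2*pi} (\<lambda>t. cis (real j * t) * (cis (- t) / 2) ^ (k + n)) =
      (if j = k + n then 2 * pi / 2 ^ j else 0)" for k
  proof -
    have "(\<lambda>t. cis (real j * t) * (cis (- t) / 2) ^ (k + n)) =
        (\<lambda>t. (1 / 2 ^ (k + n)) * (cis (real j * t) * cis (- (real (k + n) * t))))"
      by (simp only: power_divide Complex.DeMoivre) (simp add: algebra_simps)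
    then show ?thesis
      by (simp only: integral_mult_right integral_cis_mult) simp
  qed
  ultimately have *: "(\<lambda>k. if j = k + n then complex_of_real (2 * pi / 2 ^ j) else 0) sums
      integral {0..2*pi} (\<lambda>t. cis (real j * t) * tail_kernel n t)"
    by (simp add: if_distrib cong: if_cong)
  show ?thesis
  proof (cases "n \<le> j")
    case True
    then have "(\<lambda>k. if j = k + n then complex_of_real (2 * pi / 2 ^ j) else 0) =
        (\<lambda>k. if k = j - n then complex_of_real (2 * pi / 2 ^ j) else 0)" by auto
    from sums_unique2[OF *[unfolded this] sums_single] True show ?thesis by simp
  next
    case False
    then have "(\<lambda>k. if j = k + n then complex_of_real (2 * pi / 2 ^ j) else 0) = (\<lambda>k. 0)" by auto
    from sums_unique2[OF *[unfolded this] sums_zero] False show ?thesis by simp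
  qed
qed

lemma convolution_tail_kernel:
  fixes a :: "nat \<Rightarrow> complex"
  assumes F: "\<And>z. (\<lambda>k. a k * z ^ k) sums F z"
  shows "integral {0..2*pi} (\<lambda>t. F (2 * (z * cis t)) * tail_kernel n t) / (2*pi) = F z - (\<Sum>k<n. a k * z ^ k)"
proof -
  have G: "(\<lambda>k. (a k * 2 ^ k) * z ^ k) sums F (2 * z)" for z
    using F[of "2 * z"] by (simp add: power_mult_distrib mult.assoc)
  have "(\<lambda>k. a k * 2 ^ k * z ^ k * (if n \<le> k then 2 * pi / 2 ^ k else 0)) sums
          integral {0..2*pi} (\<lambda>t. F (2 * (z * cis t)) * tail_kernel n t)"
    using convolution_power_series[OF G continuous_on_tail_kernel, of z n] integral_tail_kernel by simp
  also have "(\<lambda>k. a k * 2 ^ k * z ^ k * (if n \<le> k then 2 * pi / 2 ^ k else 0)) =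
      (\<lambda>k. (a k * z ^ k - (if k \<in> {..<n} then a k * z ^ k else 0)) * (2 * pi))"
    by auto
  finally have "(\<lambda>k. (a k * z ^ k - (if k \<in> {..<n} then a k * z ^ k else 0)) * (2 * pi)) sums
      integral {0..2*pi} (\<lambda>t. F (2 * (z * cis t)) * tail_kernel n t)" .
  moreover have "(\<lambda>k. (a k * z ^ k - (if k \<in> {..<n} then a k * z ^ k else 0)) * (2 * pi)) sums
      ((F z - (\<Sum>k<n. a k * z ^ k)) * (2 * pi))"
    by (intro sums_mult2 sums_diff F sums_If_finite_set) auto
  ultimately have "integral {0..2*pi} (\<lambda>t. F (2 * (z * cis t)) * tail_kernel n t) =
      (F z - (\<Sum>k<n. a k * z ^ k)) * (2 * pi)"
    by (rule sums_unique2)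
  then show ?thesis by simp
qed

section \<open>Type of an entire function and its coefficients\<close>

lemma power_series_entire:
  fixes a :: "nat \<Rightarrow> complex"
  assumes "\<And>z. (\<lambda>k. a k * z ^ k) sums F z"
  shows "F holomorphic_on UNIV" "continuous_on A F"
proof -
  have "F holomorphic_on ball 0 r" for r
    using assms by (intro power_series_holomorphic[where a = a]) simp
  then have "F holomorphic_on (\<Union>r. ball 0 r)"
    by (intro holomorphic_on_UN_open) auto
  also have "(\<Union>r. ball (0::complex) r) = UNIV"
    by (auto intro: gt_ex)
  finally show "F holomorphic_on UNIV" .
  then show "continuous_on A F"
    by (meson continuous_on_subset holomorphic_on_imp_continuous_on subset_UNIV)
qed

section \<open>Maximum modulus and Cauchy's estimate\<close>

lemma norm_le_max_modulus:
  assumes "continuous_on (sphere 0 r) F" "norm z = r"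
  shows "norm (F z) \<le> max_modulus F r"
  unfolding max_modulus_def
proof (rule cSup_upper)
  show "bdd_above ((\<lambda>z. norm (F z)) ` sphere 0 r)"
    by (intro bounded_imp_bdd_above compact_imp_bounded compact_continuous_image continuous_on_norm assms) simp
qed (use assms in auto)

lemma max_modulus_le:
  assumes "r \<ge> 0" "\<And>z. norm z = r \<Longrightarrow> norm (F z) \<le> B"
  shows "max_modulus F r \<le> B"
  unfolding max_modulus_def using assms by (intro cSup_least) auto

lemma max_modulus_nonneg:
  assumes "continuous_on (sphere 0 r) F" "r \<ge> 0"
  shows "max_modulus F r \<ge> 0"
  using norm_le_max_modulus[OF assms(1), of "of_real r"] assms(2)
  by (intro order_trans[OF norm_ge_zero]) simp

lemma norm_coeff_le_max_modulus:
  fixes a :: "nat \<Rightarrow> complex"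
  assumes F: "\<And>z. (\<lambda>k. a k * z ^ k) sums F z" and "r \<ge> 0"
  shows "norm (a n) * r ^ n \<le> max_modulus F r"
proof -
  have cont: "continuous_on A F" for A by (rule power_series_entire(2)[OF F])
  have "norm (integral {0..2*pi} (\<lambda>t. F (r * cis t) * cis (- (real n * t)))) \<le> max_modulus F r * (2*pi - 0)"
  proof (rule integral_bound)
    show "continuous_on {0..2*pi} (\<lambda>t. F (r * cis t) * cis (- (real n * t)))"
      by (intro continuous_intros continuous_on_compose2[OF cont]) auto
    show "norm (F (r * cis t) * cis (- (real n * t))) \<le> max_modulus F r" for t
      using \<open>r \<ge> 0\<close> by (auto simp: norm_mult intro!: norm_le_max_modulus cont)
  qed simp
  then have "norm (integral {0..2*pi} (\<lambda>t. F (r * cis t) * cis (- (real n * t))) / (2*pi)) \<le> max_modulus F r"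
    by (simp add: norm_divide norm_mult field_simps)
  then show ?thesis
    using fourier_coefficient_power_series[OF F, of "of_real r" n] \<open>r \<ge> 0\<close>
    by (simp add: norm_mult norm_power)
qed

text \<open>Cauchy's estimate bounds \<open>norm (a n)\<close> by
  \<open>exp (s * r powr \<rho>) / r ^ n\<close>. The radius with
  \<open>r powr \<rho> = n / (s * \<rho>)\<close> minimises this quotient and yields the stated
  bound exactly; it tends to infinity with \<open>n\<close>, so the hypothesis on large radii
  applies.\<close>

lemma coeff_growth_from_type:
  fixes a :: "nat \<Rightarrow> complex"
  assumes F: "\<And>z. (\<lambda>k. a k * z ^ k) sums F z" and "\<rho> > 0" "s > 0"
    and ev: "\<forall>\<^sub>F r in at_top. ln (max_modulus F r) / r powr \<rho> \<le> s"
  shows "\<forall>\<^sub>F n in sequentially. norm (a n) \<le> (exp 1 * \<rho> * s / real n) powr (real n / \<rho>)"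
proof -
  have cont: "continuous_on A F" for A by (rule power_series_entire(2)[OF F])
  have "filterlim (\<lambda>n. (real n / (s * \<rho>)) powr (1 / \<rho>)) at_top sequentially"
    using assms(2,3) by real_asymp
  from eventually_compose_filterlim[OF ev this] eventually_ge_at_top[of 1]
  show ?thesis
  proof eventually_elim
    case (elim n)
    define y where "y = real n / (s * \<rho>)"
    define r where "r = y powr (1 / \<rho>)"
    have y: "y > 0" using elim assms by (simp add: y_def)
    then have r: "r > 0" "r powr \<rho> = y" "r ^ n = y powr (real n / \<rho>)"
      using \<open>\<rho> > 0\<close> elim by (simp_all add: r_def powr_powr powr_power)
    \<comment> \<open>A vanishing maximum modulus is treated apart, because its logarithm has the
      default value 0 and cannot be inverted.\<close>
    have "max_modulus F r \<le> exp (s * y)"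
    proof (cases "max_modulus F r = 0")
      case False
      then have pos: "max_modulus F r > 0" using max_modulus_nonneg[OF cont, of r] r by force
      have "ln (max_modulus F r) \<le> s * y"
        using elim r y unfolding r_def[symmetric] y_def[symmetric] by (simp add: field_simps)
      then show ?thesis using pos by (metis exp_le_cancel_iff exp_ln)
    qed simp
    then have "norm (a n) * r ^ n \<le> exp (s * y)"
      using norm_coeff_le_max_modulus[OF F, of r n] r by simp
    then have "norm (a n) \<le> exp (s * y) / y powr (real n / \<rho>)"
      using r y by (simp add: field_simps)
    also have "s * y = real n / \<rho>" using assms by (simp add: y_def)
    also have "exp (real n / \<rho>) / y powr (real n / \<rho>) = (exp 1 / y) powr (real n / \<rho>)"
      using y by (simp add: powr_divide powr_def[of "exp 1"])
    also have "exp 1 / y = exp 1 * \<rho> * s / real n" by (simp add: y_def mult_ac)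
    finally show ?case .
  qed
qed

text \<open>As a function of \<open>x\<close> the left side is largest at \<open>x = w\<close>; the
  bound is the inequality ln y \<le> y - 1 at y = w / x. It will control the maximal term of a power
  series.\<close>

lemma powr_le_exp:
  fixes w x :: real
  assumes "w > 0" "x > 0"
  shows "(exp 1 * w / x) powr x \<le> exp w"
proof -
  have "ln (w / x) \<le> w / x - 1" using assms by (intro ln_le_minus_one) simp
  then have "x * (1 + ln (w / x)) \<le> x * (w / x)" using assms by (intro mult_left_mono) auto
  then have "x * (1 + ln (w / x)) \<le> w" using assms by simp
  moreover have "ln (exp 1 * w / x) = 1 + ln (w / x)"
    using assms by (simp add: ln_mult ln_div)
  ultimately show ?thesis using assms by (simp add: powr_def)
qed

text \<open>The coefficients are compared with a majorant \<open>D\<close> of the slightly larger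
  type \<open>t\<close>, damped by \<open>\<theta> ^ n\<close>. Each term \<open>D n * r ^ n\<close>
  is at most \<open>\<theta> ^ n * exp (t * r powr \<rho>)\<close>, so summation costs only a
  constant, which dividing by \<open>r powr \<rho>\<close> removes in the limit.\<close>

lemma type_from_coeff_growth:
  fixes a :: "nat \<Rightarrow> complex"
  assumes F: "\<And>z. (\<lambda>k. a k * z ^ k) sums F z" and "\<rho> > 0" "s > 0" "s < s'"
    and ev: "\<forall>\<^sub>F n in sequentially. norm (a n) \<le> (exp 1 * \<rho> * s / real n) powr (real n / \<rho>)"
  shows "\<forall>\<^sub>F r in at_top. ln (max_modulus F r) / r powr \<rho> \<le> s'"
proof -
  have cont: "continuous_on A F" for A by (rule power_series_entire(2)[OF F])
  \<comment> \<open>the gap between \<open>s\<close> and \<open>t\<close> turns the maximal-term bound into a geometric series\<close>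
  obtain t where t: "s < t" "t < s'" using \<open>s < s'\<close> dense by blast
  define \<theta> where "\<theta> = (s / t) powr (1 / \<rho>)"
  have \<theta>: "0 < \<theta>" "\<theta> < 1"
    using powr_less_mono2[of "1 / \<rho>" "s / t" 1] t assms by (auto simp: \<theta>_def)
  \<comment> \<open>At \<open>n = 0\<close> the formula would divide by zero; the value 1 keeps
    \<open>D\<close> positive, as the quotients defining \<open>A\<close> require.\<close>
  define D where "D n = (if n = 0 then 1 else \<theta> ^ n * (exp 1 * \<rho> * t / real n) powr (real n / \<rho>))" for n
  have D_pos: "D n > 0" for n using \<theta> t assms by (auto simp: D_def)
  obtain n0 where n0: "n0 \<ge> 1" "\<And>n. n \<ge> n0 \<Longrightarrow> norm (a n) \<le> (exp 1 * \<rho> * s / real n) powr (real n / \<rho>)"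
    using eventually_conj[OF ev eventually_ge_at_top[of 1]] unfolding eventually_sequentially
    by (metis max.cobounded1 max.bounded_iff)
  \<comment> \<open>The sum absorbs the finitely many coefficients before \<open>n0\<close>. The
    summand 1 covers the others and makes \<open>K\<close> at least 1.\<close>
  define A where "A = 1 + (\<Sum>k<n0. norm (a k) / D k)"
  have A: "A \<ge> 1" using less_imp_le[OF D_pos] by (auto simp: A_def intro!: sum_nonneg)
  have a_le: "norm (a n) \<le> A * D n" for n
  proof (cases "n < n0")
    case True
    have "norm (a n) / D n \<le> (\<Sum>k<n0. norm (a k) / D k)"
      using True less_imp_le[OF D_pos] by (intro member_le_sum) auto
    then have "norm (a n) / D n \<le> A" by (simp add: A_def)
    then show ?thesis using D_pos[of n] by (simp add: field_simps)
  next
    case False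
    then have n: "n \<ge> n0" "n \<ge> 1" using n0 by auto
    have "\<theta> ^ n = (s / t) powr (real n / \<rho>)" using n by (simp add: \<theta>_def powr_nat_div_eq)
    then have "D n = (s / t * (exp 1 * \<rho> * t / real n)) powr (real n / \<rho>)"
      using n t assms by (subst powr_mult) (auto simp: D_def)
    also have "s / t * (exp 1 * \<rho> * t / real n) = exp 1 * \<rho> * s / real n"
      using t assms by simp
    finally have "norm (a n) \<le> 1 * D n" using n0 n by simp
    also have "\<dots> \<le> A * D n" using A less_imp_le[OF D_pos] by (intro mult_right_mono) auto
    finally show ?thesis .
  qed
  have D_le: "D n * r ^ n \<le> \<theta> ^ n * exp (t * r powr \<rho>)" if "r > 0" for n r
  proof (cases "n = 0")
    case True
    then show ?thesis using t assms that by (simp add: D_def)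
  next
    case False
    define x where "x = real n / \<rho>"
    have x: "x > 0" using False assms by (simp add: x_def)
    have "r ^ n = (r powr \<rho>) powr x"
      using that assms by (simp add: x_def powr_powr powr_realpow)
    then have "D n * r ^ n = \<theta> ^ n * ((exp 1 * \<rho> * t / real n) * r powr \<rho>) powr x"
      using False t assms that by (subst powr_mult) (auto simp: D_def x_def)
    also have "(exp 1 * \<rho> * t / real n) * r powr \<rho> = exp 1 * (t * r powr \<rho>) / x"
      using assms by (simp add: x_def field_simps)
    also have "\<theta> ^ n * \<dots> powr x \<le> \<theta> ^ n * exp (t * r powr \<rho>)"
      using \<theta> x t assms that by (intro mult_left_mono powr_le_exp) auto
    finally show ?thesis .
  qed
  define K where "K = A / (1 - \<theta>)"
  have K: "K \<ge> 1" using A \<theta> by (simp add: K_def field_simps)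
  have M_le: "max_modulus F r \<le> K * exp (t * r powr \<rho>)" if "r > 0" for r
  proof (rule max_modulus_le)
    fix z :: complex assume z: "norm z = r"
    have sum_a: "summable (\<lambda>k. norm (a k * z ^ k))"
      using power_series_abs_summable[OF F, of z] by (simp add: norm_mult norm_power)
    have "norm (F z) = norm (\<Sum>k. a k * z ^ k)" using F by (simp add: sums_iff)
    also have "\<dots> \<le> (\<Sum>k. norm (a k * z ^ k))" using sum_a by (rule summable_norm)
    also have "\<dots> \<le> (\<Sum>k. A * exp (t * r powr \<rho>) * \<theta> ^ k)"
    proof (rule suminf_le[OF _ sum_a])
      fix k
      have "norm (a k * z ^ k) \<le> A * D k * r ^ k"
        using a_le[of k] that z by (auto simp: norm_mult norm_power intro!: mult_right_mono)
      also have "\<dots> \<le> A * (\<theta> ^ k * exp (t * r powr \<rho>))"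
        using D_le[OF that] A by (simp add: mult.assoc)
      finally show "norm (a k * z ^ k) \<le> A * exp (t * r powr \<rho>) * \<theta> ^ k" by (simp add: mult_ac)
      show "summable (\<lambda>k. A * exp (t * r powr \<rho>) * \<theta> ^ k)"
        using \<theta> by (intro summable_mult summable_geometric) auto
    qed
    also have "\<dots> = K * exp (t * r powr \<rho>)"
      using \<theta> by (simp add: suminf_mult suminf_geometric summable_geometric K_def)
    finally show "norm (F z) \<le> K * exp (t * r powr \<rho>)" .
  qed (use that in simp)
  \<comment> \<open>If the maximum modulus is 0, its logarithm is 0 by convention, and the bound
    holds because \<open>ln K\<close> is nonnegative.\<close>
  have ln_le: "ln (max_modulus F r) \<le> ln K + t * r powr \<rho>" if "r > 0" for r
  proof (cases "max_modulus F r = 0")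
    case True
    then show ?thesis using K t assms by simp
  next
    case False
    then have "max_modulus F r > 0" using max_modulus_nonneg[OF cont, of r] that by force
    then have "ln (max_modulus F r) \<le> ln (K * exp (t * r powr \<rho>))"
      using M_le[OF that] K by (subst ln_le_cancel_iff) auto
    then show ?thesis using K by (simp add: ln_mult)
  qed
  have "((\<lambda>r. ln K / r powr \<rho> + t) \<longlongrightarrow> 0 + t) at_top"
    using \<open>\<rho> > 0\<close> by (intro tendsto_add tendsto_const) real_asymp
  then have "\<forall>\<^sub>F r in at_top. ln K / r powr \<rho> + t < s'"
    using t by (intro order_tendstoD) auto
  then show ?thesis using eventually_gt_at_top[of 0]
  proof eventually_elim
    case (elim r)
    have "ln (max_modulus F r) / r powr \<rho> \<le> (ln K + t * r powr \<rho>) / r powr \<rho>"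
      using ln_le[of r] elim by (intro divide_right_mono) auto
    also have "\<dots> = ln K / r powr \<rho> + t" using elim by (simp add: field_simps)
    finally show ?case using elim by simp
  qed
qed

lemma coeff_transfer_le:
  fixes a :: "nat \<Rightarrow> complex"
  assumes F: "\<And>z. (\<lambda>k. a k * z ^ k) sums F z" and "\<rho> > 0" "s > 0" "s < s'"
  shows "(\<forall>\<^sub>F r in at_top. ln (max_modulus F r) / r powr \<rho> \<le> s) \<Longrightarrow>
           (\<forall>\<^sub>F n in sequentially. real n / (exp 1 * \<rho>) * norm (a n) powr (\<rho> / real n) \<le> s')"
    and "(\<forall>\<^sub>F n in sequentially. real n / (exp 1 * \<rho>) * norm (a n) powr (\<rho> / real n) \<le> s) \<Longrightarrow>
           (\<forall>\<^sub>F r in at_top. ln (max_modulus F r) / r powr \<rho> \<le> s')"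
proof -
  assume "\<forall>\<^sub>F r in at_top. ln (max_modulus F r) / r powr \<rho> \<le> s"
  from coeff_growth_from_type[OF F \<open>\<rho> > 0\<close> \<open>s > 0\<close> this] eventually_ge_at_top[of 1]
  show "\<forall>\<^sub>F n in sequentially. real n / (exp 1 * \<rho>) * norm (a n) powr (\<rho> / real n) \<le> s'"
  proof eventually_elim
    case (elim n)
    then have "real n / (exp 1 * \<rho>) * norm (a n) powr (\<rho> / real n) \<le> s"
      using assms by (subst growth_le_iff) auto
    then show ?case using assms by linarith
  qed
next
  assume "\<forall>\<^sub>F n in sequentially. real n / (exp 1 * \<rho>) * norm (a n) powr (\<rho> / real n) \<le> s"
  then have "\<forall>\<^sub>F n in sequentially. norm (a n) \<le> (exp 1 * \<rho> * s / real n) powr (real n / \<rho>)"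
    using eventually_ge_at_top[of 1]
    by eventually_elim (use assms growth_le_iff in auto)
  then show "\<forall>\<^sub>F r in at_top. ln (max_modulus F r) / r powr \<rho> \<le> s'"
    by (rule type_from_coeff_growth[OF F assms(2-4)])
qed

text \<open>Type at most \<sigma> gives \<open>ln M \<le> (\<sigma> + 1) * r powr \<rho>\<close> for
  large \<open>r\<close>, hence order at most \<rho>. An order below \<rho> would bound
  \<open>ln M\<close> by \<open>r powr d\<close> with \<open>d < \<rho>\<close>, making the type at
  most \<sigma> / 2. The nonzero coefficient of positive index excludes constants, for which the
  iterated logarithm carries no growth information.\<close>

lemma order_from_type:
  fixes a :: "nat \<Rightarrow> complex"
  assumes F: "\<And>z. (\<lambda>k. a k * z ^ k) sums F z" and "\<rho> > 0" "\<sigma> > 0"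
    and k: "k \<ge> 1" "a k \<noteq> 0"
    and type: "Limsup at_top (\<lambda>r. ereal (ln (max_modulus F r) / r powr \<rho>)) = ereal \<sigma>"
  shows "Limsup at_top (\<lambda>r. ereal (ln (ln (max_modulus F r)) / ln r)) = ereal \<rho>"
proof (rule antisym)
  \<comment> \<open>By Cauchy's estimate this single term forces the maximum modulus above 1, so
    that both logarithms have positive arguments.\<close>
  have "filterlim (\<lambda>r. norm (a k) * r ^ k) at_top at_top"
    using k by (intro filterlim_tendsto_pos_mult_at_top[OF tendsto_const] filterlim_pow_at_top filterlim_ident) auto
  then have "\<forall>\<^sub>F r in at_top. norm (a k) * r ^ k > 1"
    by (simp add: filterlim_at_top_dense)
  then have M_gt: "\<forall>\<^sub>F r in at_top. max_modulus F r > 1"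
    using eventually_ge_at_top[of 0]
    by eventually_elim (use norm_coeff_le_max_modulus[OF F] in \<open>force intro: less_le_trans\<close>)
  have "\<forall>\<^sub>F r in at_top. ereal (ln (max_modulus F r) / r powr \<rho>) < ereal (\<sigma> + 1)"
    using type by (intro Limsup_lessD) simp
  then have upper: "\<forall>\<^sub>F r in at_top. ereal (ln (ln (max_modulus F r)) / ln r) \<le> ereal ((ln (\<sigma> + 1) + \<rho> * ln r) / ln r)"
    using M_gt eventually_gt_at_top[of 1]
  proof eventually_elim
    case (elim r)
    then have "ln (max_modulus F r) \<le> (\<sigma> + 1) * r powr \<rho>" by (simp add: field_simps)
    then have "ln (ln (max_modulus F r)) \<le> ln ((\<sigma> + 1) * r powr \<rho>)"
      using elim \<open>\<sigma> > 0\<close> by (subst ln_le_cancel_iff) auto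
    also have "\<dots> = ln (\<sigma> + 1) + \<rho> * ln r"
      using elim \<open>\<sigma> > 0\<close> by (simp add: ln_mult ln_powr)
    finally show ?case using elim by (simp add: divide_right_mono)
  qed
  have "((\<lambda>r. (ln (\<sigma> + 1) + \<rho> * ln r) / ln r) \<longlongrightarrow> \<rho>) at_top"
    using assms by real_asymp
  then have "Limsup at_top (\<lambda>r. ereal ((ln (\<sigma> + 1) + \<rho> * ln r) / ln r)) = ereal \<rho>"
    by (intro lim_imp_Limsup) auto
  with Limsup_mono[OF upper]
  show "Limsup at_top (\<lambda>r. ereal (ln (ln (max_modulus F r)) / ln r)) \<le> ereal \<rho>" by simp
  show "ereal \<rho> \<le> Limsup at_top (\<lambda>r. ereal (ln (ln (max_modulus F r)) / ln r))"
  proof (rule ccontr)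
    assume "\<not> ?thesis"
    then obtain d where d: "Limsup at_top (\<lambda>r. ereal (ln (ln (max_modulus F r)) / ln r)) < ereal d" "d < \<rho>"
      using ereal_dense2[of _ "ereal \<rho>"] by (metis ereal_less_eq(3) not_le ereal_less(1) less_ereal.simps(1))
    have "((\<lambda>r. r powr (d - \<rho>)) \<longlongrightarrow> 0) at_top"
      using d(2) by real_asymp
    then have "\<forall>\<^sub>F r in at_top. r powr (d - \<rho>) < \<sigma> / 2"
      using \<open>\<sigma> > 0\<close> by (intro order_tendstoD) auto
    with Limsup_lessD[OF d(1)] have "\<forall>\<^sub>F r in at_top. ln (max_modulus F r) / r powr \<rho> \<le> \<sigma> / 2"
      using M_gt eventually_gt_at_top[of 1]
    proof eventually_elim
      case (elim r)
      then have "ln (ln (max_modulus F r)) < ln (r powr d)"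
        by (simp add: ln_powr field_simps)
      then have "ln (max_modulus F r) < r powr d"
        using elim by (subst (asm) ln_less_cancel_iff) auto
      then have "ln (max_modulus F r) / r powr \<rho> \<le> r powr d / r powr \<rho>"
        by (intro divide_right_mono) auto
      also have "\<dots> = r powr (d - \<rho>)" by (simp add: powr_diff)
      also have "\<dots> \<le> \<sigma> / 2" using elim by simp
      finally show ?case .
    qed
    then have "Limsup at_top (\<lambda>r. ereal (ln (max_modulus F r) / r powr \<rho>)) \<le> ereal (\<sigma> / 2)"
      by (intro Limsup_bounded) simp
    then show False using type \<open>\<sigma> > 0\<close> by simp
  qed
qed

lemma coeff_limsup_eq_type:
  fixes a :: "nat \<Rightarrow> complex"
  assumes F: "\<And>z. (\<lambda>k. a k * z ^ k) sums F z" and "\<rho> > 0" "\<sigma> > 0"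
  shows "entire_order_type F \<rho> \<sigma> \<longleftrightarrow>
    limsup (\<lambda>n. ereal (real n / (exp 1 * \<rho>) * norm (a n) powr (\<rho> / real n))) = ereal \<sigma>"
proof -
  let ?L = "\<lambda>r. ln (max_modulus F r) / r powr \<rho>"
  let ?u = "\<lambda>n. real n / (exp 1 * \<rho>) * norm (a n) powr (\<rho> / real n)"
  have Lu: "\<forall>\<^sub>F n in sequentially. ?u n \<le> s'" if "0 < s" "s < s'" "\<forall>\<^sub>F r in at_top. ?L r \<le> s" for s s'
    by (rule coeff_transfer_le(1)[OF F assms(2) that])
  have uL: "\<forall>\<^sub>F r in at_top. ?L r \<le> s'" if "0 < s" "s < s'" "\<forall>\<^sub>F n in sequentially. ?u n \<le> s" for s s'
    by (rule coeff_transfer_le(2)[OF F assms(2) that])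
  have type_iff: "Limsup at_top (\<lambda>r. ereal (?L r)) = ereal \<sigma> \<longleftrightarrow> limsup (\<lambda>n. ereal (?u n)) = ereal \<sigma>"
    by (rule Limsup_transfer_iff; fact Lu uL \<open>\<sigma> > 0\<close>)
  have "entire_order_type F \<rho> \<sigma>" if lim: "limsup (\<lambda>n. ereal (?u n)) = ereal \<sigma>"
  proof -
  \<comment> \<open>Otherwise all terms with \<open>n \<ge> 1\<close> would vanish and the limit
    superior could not be positive.\<close>
  have "\<exists>k\<ge>1. a k \<noteq> 0"
  proof (rule ccontr)
    assume "\<not> ?thesis"
    then have "\<forall>\<^sub>F n in sequentially. ereal (real n / (exp 1 * \<rho>) * norm (a n) powr (\<rho> / real n)) \<le> 0"
      by (intro eventually_sequentiallyI[of 1]) auto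
    then have "limsup (\<lambda>n. ereal (real n / (exp 1 * \<rho>) * norm (a n) powr (\<rho> / real n))) \<le> 0"
      by (rule Limsup_bounded)
    then show False using lim \<open>\<sigma> > 0\<close> by simp
  qed
  then obtain k where "k \<ge> 1" "a k \<noteq> 0" by blast
  then show ?thesis
    unfolding entire_order_type_def
    using order_from_type[OF F assms(2,3)] lim type_iff power_series_entire(1)[OF F] by blast
  qed
  with type_iff show ?thesis by (auto simp: entire_order_type_def)
qed

section \<open>Best approximation in admissible spaces\<close>

locale admissible =
  fixes X :: "(complex \<Rightarrow> complex) set" and N :: "(complex \<Rightarrow> complex) \<Rightarrow> real"
  assumes admissible: "admissible_space X N"
begin

lemma
  shows N_cong: "f \<in> X \<Longrightarrow> (\<And>z. z \<in> udisc \<Longrightarrow> g z = f z) \<Longrightarrow> N g = N f"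
    and add_in: "f \<in> X \<Longrightarrow> g \<in> X \<Longrightarrow> (\<lambda>z. f z + g z) \<in> X"
    and scale_in: "f \<in> X \<Longrightarrow> (\<lambda>z. c * f z) \<in> X"
    and N_nonneg: "f \<in> X \<Longrightarrow> 0 \<le> N f"
    and N_zero_iff: "f \<in> X \<Longrightarrow> N f = 0 \<longleftrightarrow> (\<forall>z\<in>udisc. f z = 0)"
    and N_scale: "f \<in> X \<Longrightarrow> N (\<lambda>z. c * f z) = norm c * N f"
    and N_add: "f \<in> X \<Longrightarrow> g \<in> X \<Longrightarrow> N (\<lambda>z. f z + g z) \<le> N f + N g"
proof -
  have "fun_banach_space X N" using admissible by (simp only: admissible_space_def)
  then have
    "\<forall>f g. f \<in> X \<longrightarrow> (\<forall>z\<in>udisc. g z = f z) \<longrightarrow> g \<in> X \<and> N g = N f"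
    "\<forall>f\<in>X. \<forall>g\<in>X. (\<lambda>z. f z + g z) \<in> X" "\<forall>f\<in>X. \<forall>c::complex. (\<lambda>z. c * f z) \<in> X"
    "\<forall>f\<in>X. N f \<ge> 0" "\<forall>f\<in>X. N f = 0 \<longleftrightarrow> (\<forall>z\<in>udisc. f z = 0)"
    "\<forall>f\<in>X. \<forall>c::complex. N (\<lambda>z. c * f z) = norm c * N f"
    "\<forall>f\<in>X. \<forall>g\<in>X. N (\<lambda>z. f z + g z) \<le> N f + N g"
    unfolding fun_banach_space_def by - (elim conjE, assumption)+
  note * = this[rule_format]
  show "f \<in> X \<Longrightarrow> (\<And>z. z \<in> udisc \<Longrightarrow> g z = f z) \<Longrightarrow> N g = N f"
    by (rule *(1)[THEN conjunct2])
  show "f \<in> X \<Longrightarrow> g \<in> X \<Longrightarrow> (\<lambda>z. f z + g z) \<in> X" by (rule *(2))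
  show "f \<in> X \<Longrightarrow> (\<lambda>z. c * f z) \<in> X" by (rule *(3))
  show "f \<in> X \<Longrightarrow> 0 \<le> N f" by (rule *(4))
  show "f \<in> X \<Longrightarrow> N f = 0 \<longleftrightarrow> (\<forall>z\<in>udisc. f z = 0)" by (rule *(5))
  show "f \<in> X \<Longrightarrow> N (\<lambda>z. c * f z) = norm c * N f" by (rule *(6))
  show "f \<in> X \<Longrightarrow> g \<in> X \<Longrightarrow> N (\<lambda>z. f z + g z) \<le> N f + N g" by (rule *(7))
qed

lemma entire_in: "f holomorphic_on UNIV \<Longrightarrow> f \<in> X"
proof -
  have "\<forall>f. f holomorphic_on UNIV \<longrightarrow> f \<in> X"
    using admissible unfolding admissible_space_def by (elim conjE)
  then show "f holomorphic_on UNIV \<Longrightarrow> f \<in> X" by blast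
qed

lemma N_convolution_le:
  assumes "f \<in> X" "continuous_on {0..2*pi} g"
  shows "N (\<lambda>z. integral {0..2*pi} (\<lambda>t. f (z * cis t) * g t) / (2*pi))
          \<le> integral {0..2*pi} (\<lambda>t. norm (g t)) / (2*pi) * N f"
proof -
  have "\<forall>f\<in>X. \<forall>g::real \<Rightarrow> complex. g absolutely_integrable_on {0..2*pi} \<longrightarrow>
        (\<lambda>z. integral {0..2*pi} (\<lambda>t. f (z * cis t) * g t) / (2*pi)) \<in> X \<and>
        N (\<lambda>z. integral {0..2*pi} (\<lambda>t. f (z * cis t) * g t) / (2*pi))
          \<le> integral {0..2*pi} (\<lambda>t. norm (g t)) / (2*pi) * N f"
    using admissible unfolding admissible_space_def by (elim conjE)
  from this[rule_format, THEN conjunct2] show ?thesis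
    using assms(1) absolutely_integrable_continuous_real[OF assms(2)] .
qed

lemma diff_in: "f \<in> X \<Longrightarrow> g \<in> X \<Longrightarrow> (\<lambda>z. f z - g z) \<in> X"
  using add_in[of f "\<lambda>z. (-1) * g z"] scale_in[of g "-1"] by simp

lemma N_triangle_diff:
  assumes "f \<in> X" "g \<in> X" "h \<in> X"
  shows "N (\<lambda>z. f z - h z) \<le> N (\<lambda>z. f z - g z) + N (\<lambda>z. g z - h z)"
  using N_add[OF diff_in[OF assms(1,2)] diff_in[OF assms(2,3)]] by simp

lemma N_diff_commute:
  assumes "f \<in> X" "g \<in> X"
  shows "N (\<lambda>z. f z - g z) = N (\<lambda>z. g z - f z)"
  using N_scale[OF diff_in[OF assms], of "-1"] by simp

section \<open>Monomials, Taylor coefficients and Taylor sums in the norm of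
  \<open>X\<close>\<close>

lemma poly_in: "(\<lambda>z. \<Sum>k\<in>A. c k * z ^ k) \<in> X"
  by (intro entire_in holomorphic_intros)

definition w :: "nat \<Rightarrow> real" where "w n = N (\<lambda>z. z ^ n)"

lemma monom_in: "(\<lambda>z. z ^ n) \<in> X"
  by (intro entire_in holomorphic_intros)

lemma w_pos: "w n > 0"
proof -
  have "(1 / 2 :: complex) \<in> udisc" by (simp add: udisc_def)
  then have "w n \<noteq> 0"
    unfolding w_def N_zero_iff[OF monom_in] by (intro notI) (auto dest: bspec)
  then show ?thesis using N_nonneg[OF monom_in[of n]] by (simp add: w_def)
qed

lemma N_poly_le: "finite A \<Longrightarrow> N (\<lambda>z. \<Sum>k\<in>A. c k * z ^ k) \<le> (\<Sum>k\<in>A. norm (c k) * w k)"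
proof (induction A rule: finite_induct)
  case empty
  have "N (\<lambda>z. 0) = 0" using poly_in[of _ "{}"] by (subst N_zero_iff) auto
  then show ?case by simp
next
  case (insert k A)
  have "N (\<lambda>z. c k * z ^ k + (\<Sum>k\<in>A. c k * z ^ k)) \<le> N (\<lambda>z. c k * z ^ k) + N (\<lambda>z. \<Sum>k\<in>A. c k * z ^ k)"
    by (intro N_add scale_in monom_in poly_in)
  also have "N (\<lambda>z. c k * z ^ k) = norm (c k) * w k"
    unfolding w_def by (intro N_scale monom_in)
  finally show ?case using insert by simp
qed

text \<open>The kernel \<open>cis (- n * t)\<close> has modulus 1, hence mean modulus 1 over the
  circle, so extracting a Taylor term by convolution does not increase the norm.\<close>

lemma coeff_norm_le:
  assumes F: "\<And>z. (\<lambda>k. a k * z ^ k) sums F z"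
  shows "norm (a n) * w n \<le> N F"
proof -
  have FX: "F \<in> X" by (intro entire_in power_series_entire(1)[OF F])
  have "norm (a n) * w n = N (\<lambda>z. integral {0..2*pi} (\<lambda>t. F (z * cis t) * cis (- (real n * t))) / (2*pi))"
    unfolding fourier_coefficient_power_series[OF F] N_scale[OF monom_in] w_def ..
  also have "\<dots> \<le> integral {0..2*pi} (\<lambda>t. norm (cis (- (real n * t)))) / (2*pi) * N F"
    by (intro N_convolution_le FX continuous_intros)
  finally show ?thesis by simp
qed

lemma poly_coeff_norm_le:
  assumes "k < n"
  shows "norm (c k) * w k \<le> N (\<lambda>z. \<Sum>k<n. c k * z ^ k)"
proof -
  have "(\<lambda>k. (if k \<in> {..<n} then c k else 0) * z ^ k) sums (\<Sum>k<n. c k * z ^ k)" for z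
    using sums_If_finite_set[of "{..<n}" "\<lambda>k. c k * z ^ k"] by (simp add: if_distrib[of "\<lambda>x. x * _"] cong: if_cong)
  from coeff_norm_le[OF this, of k] assms show ?thesis by simp
qed

text \<open>The dilation of \<open>F\<close> by 2 is entire, so it has a finite norm; the remainder
  is its convolution with a kernel of mean modulus at most \<open>2 * (1 / 2) ^ n\<close>. No growth
  condition on \<open>w\<close> enters.\<close>

lemma partial_sums_tendsto:
  assumes F: "\<And>z. (\<lambda>k. a k * z ^ k) sums F z"
  shows "(\<lambda>n. N (\<lambda>z. F z - (\<Sum>k<n. a k * z ^ k))) \<longlonglongrightarrow> 0"
proof -
  have hol: "F holomorphic_on UNIV" by (rule power_series_entire(1)[OF F])
  have G: "(\<lambda>z. F (2 * z)) \<in> X"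
    by (intro entire_in holomorphic_on_compose_gen[OF _ hol, unfolded o_def] holomorphic_intros) auto
  have le: "N (\<lambda>z. F z - (\<Sum>k<n. a k * z ^ k)) \<le> 2 * N (\<lambda>z. F (2 * z)) * (1 / 2) ^ n" for n
  proof -
    have "N (\<lambda>z. F z - (\<Sum>k<n. a k * z ^ k)) =
        N (\<lambda>z. integral {0..2*pi} (\<lambda>t. F (2 * (z * cis t)) * tail_kernel n t) / (2*pi))"
      unfolding convolution_tail_kernel[OF F] ..
    also have "\<dots> \<le> integral {0..2*pi} (\<lambda>t. norm (tail_kernel n t)) / (2*pi) * N (\<lambda>z. F (2 * z))"
      by (rule N_convolution_le[OF G continuous_on_tail_kernel])
    also have "\<dots> \<le> (2 * (1 / 2) ^ n) * N (\<lambda>z. F (2 * z))"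
    proof (intro mult_right_mono N_nonneg G)
      have "norm (integral {0..2*pi} (\<lambda>t. norm (tail_kernel n t))) \<le> 2 * (1 / 2) ^ n * (2*pi - 0)"
        using norm_tail_kernel_le
        by (intro integral_bound continuous_on_norm continuous_on_tail_kernel) auto
      then have "integral {0..2*pi} (\<lambda>t. norm (tail_kernel n t)) \<le> 2 * (1 / 2) ^ n * (2*pi)"
        by simp
      then show "integral {0..2*pi} (\<lambda>t. norm (tail_kernel n t)) / (2*pi) \<le> 2 * (1 / 2) ^ n"
        by (simp only: pos_divide_le_eq pi_gt_zero mult_pos_pos zero_less_numeral)
    qed
    finally show ?thesis by (simp add: mult_ac)
  qed
  have lim: "(\<lambda>n. 2 * N (\<lambda>z. F (2 * z)) * (1 / 2) ^ n) \<longlonglongrightarrow> 0"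
    by (intro tendsto_mult_right_zero LIMSEQ_power_zero) simp
  have ge: "0 \<le> N (\<lambda>z. F z - (\<Sum>k<n. a k * z ^ k))" for n
    by (intro N_nonneg diff_in poly_in entire_in hol)
  show ?thesis
    by (rule tendsto_sandwich[OF always_eventually always_eventually tendsto_const lim]) (intro allI ge le)+
qed

section \<open>Errors of best approximation\<close>

lemma polys_in: "p \<in> polys n \<Longrightarrow> p \<in> X"
  using poly_in by (auto simp: polys_def)

lemma best_approx_err_le:
  assumes "f \<in> X" "p \<in> polys n"
  shows "best_approx_err N n f \<le> N (\<lambda>z. f z - p z)"
  unfolding best_approx_err_def
proof (rule cINF_lower)
  show "bdd_below ((\<lambda>p. N (\<lambda>z. f z - p z)) ` polys n)"
    by (intro bdd_belowI2[of _ 0] N_nonneg diff_in assms(1) polys_in)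
qed (fact assms)

lemma le_best_approx_err:
  assumes "\<And>p. p \<in> polys n \<Longrightarrow> B \<le> N (\<lambda>z. f z - p z)"
  shows "B \<le> best_approx_err N n f"
  unfolding best_approx_err_def using assms by (intro cINF_greatest) (auto simp: polys_def)

lemma best_approx_err_nonneg:
  assumes "f \<in> X"
  shows "0 \<le> best_approx_err N n f"
  by (intro le_best_approx_err N_nonneg diff_in assms polys_in)

context
  fixes f F :: "complex \<Rightarrow> complex" and a :: "nat \<Rightarrow> complex"
  assumes F: "\<And>z. (\<lambda>k. a k * z ^ k) sums F z" and fF: "\<And>z. z \<in> udisc \<Longrightarrow> f z = F z" and fX: "f \<in> X"
begin

lemma F_in: "F \<in> X"
  by (intro entire_in power_series_entire(1)[OF F])

text \<open>Members of \<open>polys n\<close> have degree below \<open>n\<close>, so subtracting one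
  leaves the n-th coefficient of \<open>F\<close> unchanged, and \<open>coeff_norm_le\<close>
  applies to the difference.\<close>

lemma coeff_le_best_approx_err: "norm (a n) * w n \<le> best_approx_err N n f"
proof (rule le_best_approx_err)
  fix p assume p: "p \<in> polys n"
  then obtain c where c: "p = (\<lambda>z. \<Sum>k<n. c k * z ^ k)" by (auto simp: polys_def)
  have "(\<lambda>k. (if k \<in> {..<n} then c k * z ^ k else 0)) sums p z" for z
    unfolding c by (rule sums_If_finite_set) simp
  then have "(\<lambda>k. a k * z ^ k - (if k \<in> {..<n} then c k * z ^ k else 0)) sums (F z - p z)" for z
    by (intro sums_diff F)
  moreover have "a k * z ^ k - (if k \<in> {..<n} then c k * z ^ k else 0) =
      (a k - (if k < n then c k else 0)) * z ^ k" for k z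
    by (auto simp: algebra_simps)
  ultimately have "(\<lambda>k. (a k - (if k < n then c k else 0)) * z ^ k) sums (F z - p z)" for z
    by (simp only:)
  from coeff_norm_le[OF this, of n] have "norm (a n) * w n \<le> N (\<lambda>z. F z - p z)" by simp
  also have "\<dots> = N (\<lambda>z. f z - p z)"
    using fF by (intro N_cong diff_in polys_in[OF p] fX) auto
  finally show "norm (a n) * w n \<le> N (\<lambda>z. f z - p z)" .
qed

text \<open>The Taylor sum of length \<open>n\<close> is the competitor. Its error is compared with
  a longer Taylor sum, so the triangle inequality is applied to finite sums only; the remaining
  error vanishes as \<open>m\<close> grows.\<close>

lemma best_approx_err_le_tail:
  assumes sum: "summable (\<lambda>k. norm (a k) * w k)"
  shows "best_approx_err N n f \<le> (\<Sum>k. norm (a (k + n)) * w (k + n))"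
proof -
  let ?S = "\<lambda>n z. \<Sum>k<n. a k * z ^ k"
  have "best_approx_err N n f \<le> N (\<lambda>z. F z - ?S (m + n) z) + (\<Sum>k. norm (a (k + n)) * w (k + n))" for m
  proof -
    have "best_approx_err N n f \<le> N (\<lambda>z. f z - ?S n z)"
      by (intro best_approx_err_le fX) (auto simp: polys_def)
    also have "\<dots> = N (\<lambda>z. F z - ?S n z)"
      using fF by (intro N_cong diff_in poly_in F_in) auto
    also have "\<dots> \<le> N (\<lambda>z. F z - ?S (m + n) z) + N (\<lambda>z. ?S (m + n) z - ?S n z)"
      by (intro N_triangle_diff F_in poly_in)
    also have "(\<lambda>z. ?S (m + n) z - ?S n z) = (\<lambda>z. \<Sum>k\<in>{n..<m+n}. a k * z ^ k)"
      by (simp add: lessThan_atLeast0 sum_diff_nat_ivl)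
    also have "N \<dots> \<le> (\<Sum>k\<in>{n..<m+n}. norm (a k) * w k)"
      by (rule N_poly_le) simp
    also have "\<dots> = (\<Sum>k<m. norm (a (k + n)) * w (k + n))"
      using sum.shift_bounds_nat_ivl[of "\<lambda>k. norm (a k) * w k" 0 n m] by (simp add: lessThan_atLeast0)
    also have "\<dots> \<le> (\<Sum>k. norm (a (k + n)) * w (k + n))"
      using less_imp_le[OF w_pos] sum
      by (intro sum_le_suminf) (auto simp: summable_iff_shift[of "\<lambda>k. norm (a k) * w k"])
    finally show ?thesis by simp
  qed
  moreover have "(\<lambda>m. N (\<lambda>z. F z - ?S (m + n) z) + (\<Sum>k. norm (a (k + n)) * w (k + n))) \<longlonglongrightarrow>
      0 + (\<Sum>k. norm (a (k + n)) * w (k + n))"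
    by (intro tendsto_intros LIMSEQ_ignore_initial_segment[OF partial_sums_tendsto[OF F]])
  ultimately show ?thesis by (intro LIMSEQ_le_const[of _ "_"]) auto
qed

lemma coeff_limsup_iff_err_limsup:
  assumes lim: "(\<lambda>n. w n powr (1 / real n)) \<longlonglongrightarrow> \<mu>" and "\<mu> > 0" and "\<rho> > 0" and "\<sigma> > 0"
  shows "limsup (\<lambda>n. ereal (real n / (exp 1 * \<rho>) * norm (a n) powr (\<rho> / real n))) = ereal \<sigma> \<longleftrightarrow>
    limsup (\<lambda>n. ereal (real n / (exp 1 * \<rho>) * (best_approx_err N n f / w n) powr (\<rho> / real n))) = ereal \<sigma>"
proof -
  let ?u = "\<lambda>n. real n / (exp 1 * \<rho>) * norm (a n) powr (\<rho> / real n)"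
  let ?v = "\<lambda>n. real n / (exp 1 * \<rho>) * (best_approx_err N n f / w n) powr (\<rho> / real n)"
  have uv: "\<forall>\<^sub>F n in sequentially. ?v n \<le> s'" if "0 < s" "s < s'" "\<forall>\<^sub>F n in sequentially. ?u n \<le> s" for s s'
  proof (rule growth_tail_transfer[OF w_pos lim \<open>\<mu> > 0\<close> _ \<open>\<rho> > 0\<close> that(1,2)])
    show "\<forall>\<^sub>F n in sequentially. norm (a n) \<le> (exp 1 * \<rho> * s / real n) powr (real n / \<rho>)"
      using that(3) eventually_ge_at_top[of 1]
      by eventually_elim (use that(1) \<open>\<rho> > 0\<close> growth_le_iff in auto)
  qed (auto intro: best_approx_err_le_tail best_approx_err_nonneg fX)
  have "?u n \<le> ?v n" for n
    using coeff_le_best_approx_err[of n] w_pos[of n] \<open>\<rho> > 0\<close>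
    by (intro mult_left_mono powr_mono2) (auto simp: field_simps)
  then have vu: "\<forall>\<^sub>F n in sequentially. ?u n \<le> s'" if "0 < s" "s < s'" "\<forall>\<^sub>F n in sequentially. ?v n \<le> s" for s s'
    using that by (elim eventually_mono) (meson less_imp_le order_trans)
  show ?thesis
    by (rule Limsup_transfer_iff; fact uv vu \<open>\<sigma> > 0\<close>)
qed

end

text \<open>Two approximants differ in norm by at most the sum of their errors, and coefficient
  extraction passes this on to each coefficient. The limits of the coefficients inherit the decay of
  the errors, which makes \<open>F\<close> entire. The condition \<open>r < \<mu>\<close> makes the
  coefficient errors, of size \<open>E n / w k\<close>, summable against
  \<open>r ^ k\<close>.\<close>

lemma best_approx_limit_entire:
  assumes lim: "(\<lambda>n. w n powr (1 / real n)) \<longlonglongrightarrow> \<mu>" and "\<mu> > 0" and fX: "f \<in> X" and "\<rho> > 0" and "\<sigma> > 0"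
    and err: "limsup (\<lambda>n. ereal (real n / (exp 1 * \<rho>) * (best_approx_err N n f / w n) powr (\<rho> / real n))) = ereal \<sigma>"
    and p: "\<And>n. n \<ge> 1 \<Longrightarrow> p n \<in> polys n" "\<And>n. n \<ge> 1 \<Longrightarrow> N (\<lambda>z. f z - p n z) = best_approx_err N n f"
  obtains a F where "\<And>z. (\<lambda>k. a k * z ^ k) sums F z" "\<And>z. z \<in> udisc \<Longrightarrow> f z = F z"
    "\<And>r. 0 < r \<Longrightarrow> r < \<mu> \<Longrightarrow> uniform_limit (ball 0 r) p F sequentially"
proof -
  define E where "E n = best_approx_err N n f" for n
  have E_nonneg: "E n \<ge> 0" for n unfolding E_def by (rule best_approx_err_nonneg[OF fX])
  \<comment> \<open>Any level above \<sigma> would do: only superexponential decay is needed here,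
    not the exact type.\<close>
  define C where "C = exp 1 * \<rho> * (\<sigma> + 1)"
  have C: "C > 0" using assms by (simp add: C_def)
  have "\<forall>\<^sub>F n in sequentially. ereal (real n / (exp 1 * \<rho>) * (E n / w n) powr (\<rho> / real n)) < ereal (\<sigma> + 1)"
    using err unfolding E_def by (intro Limsup_lessD) simp
  then have E_growth: "\<forall>\<^sub>F n in sequentially. E n / w n \<le> (C / real n) powr (real n / \<rho>)"
    using eventually_ge_at_top[of 1]
  proof eventually_elim
    case (elim n)
    have "E n / w n \<ge> 0" using E_nonneg[of n] w_pos[of n] by simp
    then show ?case
      using elim growth_le_iff[of n "E n / w n" "\<sigma> + 1" \<rho>] assms by (simp add: C_def)
  qed
  have w_lower: "\<forall>\<^sub>F n in sequentially. \<nu> ^ n \<le> w n" if "0 < \<nu>" "\<nu> < \<mu>" for \<nu>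
    using order_tendstoD(1)[OF lim that(2)] eventually_ge_at_top[of 1]
  proof eventually_elim
    case (elim n)
    have "w n = (w n powr (1 / real n)) ^ n" using w_pos[of n] elim by (simp add: powr_power)
    then show ?case using elim that by (metis less_imp_le power_mono)
  qed
  have w_upper: "\<forall>\<^sub>F n in sequentially. w n \<le> (\<mu> + 1) ^ n"
    using order_tendstoD(2)[OF lim, of "\<mu> + 1", simplified] eventually_ge_at_top[of 1]
  proof eventually_elim
    case (elim n)
    have "w n = (w n powr (1 / real n)) ^ n" using w_pos[of n] elim by (simp add: powr_power)
    then show ?case using elim by (metis less_imp_le power_mono powr_ge_zero)
  qed
  have "\<forall>\<^sub>F n in sequentially. E n / w n * (\<mu> + 1) ^ n \<le> (1 / 2) ^ n"
    by (rule eventually_supergeometric[OF C \<open>\<rho> > 0\<close> _ _ E_growth]) (use \<open>\<mu> > 0\<close> in auto)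
  with w_upper have "\<forall>\<^sub>F n in sequentially. E n \<le> (1 / 2) ^ n"
  proof eventually_elim
    case (elim n)
    have "E n = E n / w n * w n" using w_pos[of n] by simp
    also have "\<dots> \<le> E n / w n * (\<mu> + 1) ^ n"
      using elim E_nonneg[of n] w_pos[of n] by (intro mult_left_mono) auto
    finally show ?case using elim by simp
  qed
  then have E_small: "\<forall>\<^sub>F n in sequentially. norm (real n * E n) \<le> real n * (1 / 2) ^ n"
    by eventually_elim (use E_nonneg in \<open>auto simp: abs_mult intro!: mult_left_mono\<close>)
  \<comment> \<open>The factor \<open>n\<close> pays for adding up \<open>n\<close> coefficient
    errors, each at most \<open>E n\<close>, when \<open>p n\<close> is compared in norm with the
    Taylor sum of \<open>F\<close>.\<close>
  have nE: "(\<lambda>n. real n * E n) \<longlonglongrightarrow> 0"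
    by (rule Lim_null_comparison[OF E_small]) real_asymp
  have E0: "E \<longlonglongrightarrow> 0"
  proof (rule Lim_null_comparison[OF _ nE])
    show "\<forall>\<^sub>F n in sequentially. norm (E n) \<le> real n * E n"
      using eventually_ge_at_top[of 1]
    proof eventually_elim
      case (elim n)
      then show ?case using mult_right_mono[of 1 "real n" "E n"] E_nonneg[of n] by simp
    qed
  qed

  have "\<forall>n. \<exists>c. n \<ge> 1 \<longrightarrow> p n = (\<lambda>z. \<Sum>k<n. c k * z ^ k)"
    using p(1) by (auto simp: polys_def)
  then obtain c0 where c0: "\<And>n. n \<ge> 1 \<Longrightarrow> p n = (\<lambda>z. \<Sum>k<n. c0 n k * z ^ k)" by metis
  \<comment> \<open>Padding with zeros lets approximants of different degrees be written as sums of
    one common length.\<close>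
  define c where "c n k = (if k < n then c0 n k else 0)" for n k
  have p_eq: "p n = (\<lambda>z. \<Sum>k<m. c n k * z ^ k)" if "1 \<le> n" "n \<le> m" for m n
  proof
    fix z
    have "(\<Sum>k<m. c n k * z ^ k) = (\<Sum>k<n. c n k * z ^ k)"
      using that by (intro sum.mono_neutral_right) (auto simp: c_def)
    then show "p n z = (\<Sum>k<m. c n k * z ^ k)" using that by (simp add: c0 c_def)
  qed
  have pX: "p n \<in> X" if "n \<ge> 1" for n using p(1)[OF that] by (rule polys_in)
  have c_diff: "norm (c m k - c n k) * w k \<le> E m + E n" if "1 \<le> m" "1 \<le> n" for m n k
  proof -
    define l where "l = Suc k + m + n"
    have "norm (c m k - c n k) * w k \<le> N (\<lambda>z. \<Sum>k<l. (c m k - c n k) * z ^ k)"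
      by (rule poly_coeff_norm_le) (simp add: l_def)
    also have "(\<lambda>z. \<Sum>k<l. (c m k - c n k) * z ^ k) = (\<lambda>z. p m z - p n z)"
      using p_eq[of m l] p_eq[of n l] that by (simp add: l_def sum_subtractf left_diff_distrib)
    also have "N \<dots> \<le> N (\<lambda>z. p m z - f z) + N (\<lambda>z. f z - p n z)"
      by (intro N_triangle_diff pX that fX)
    also have "N (\<lambda>z. p m z - f z) = N (\<lambda>z. f z - p m z)"
      by (intro N_diff_commute pX that fX)
    finally show ?thesis using p(2) that by (simp add: E_def)
  qed
  have "convergent (\<lambda>m. c m k)" for k
  proof (rule Cauchy_convergent, rule CauchyI)
    fix e :: real assume "e > 0"
    then have "e * w k / 2 > 0" using w_pos[of k] by simp
    from order_tendstoD(2)[OF E0 this] eventually_ge_at_top[of 1]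
    obtain M where M: "\<And>n. n \<ge> M \<Longrightarrow> E n < e * w k / 2 \<and> n \<ge> 1"
      using eventually_conj unfolding eventually_sequentially by (metis (lifting) max.bounded_iff)
    have "norm (c m k - c n k) < e" if "m \<ge> M" "n \<ge> M" for m n
    proof -
      have "norm (c m k - c n k) * w k < e * w k"
        using c_diff[of m n k] M[OF that(1)] M[OF that(2)] by linarith
      then show ?thesis using w_pos[of k] by simp
    qed
    then show "\<exists>M. \<forall>m\<ge>M. \<forall>n\<ge>M. norm (c m k - c n k) < e" by blast
  qed
  then have "\<exists>l. (\<lambda>m. c m k) \<longlonglongrightarrow> l" for k by (simp add: convergent_def)
  then obtain a where a: "\<And>k. (\<lambda>m. c m k) \<longlonglongrightarrow> a k" by metis
  \<comment> \<open>Let \<open>m\<close> tend to infinity in \<open>c_diff\<close>; the bound does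
    not depend on \<open>k\<close>.\<close>
  have a_diff: "norm (a k - c n k) * w k \<le> E n" if "n \<ge> 1" for n k
  proof (rule LIMSEQ_le)
    show "(\<lambda>m. norm (c m k - c n k) * w k) \<longlonglongrightarrow> norm (a k - c n k) * w k"
      by (intro tendsto_intros a)
    show "(\<lambda>m. E m + E n) \<longlonglongrightarrow> E n"
      using tendsto_add[OF E0 tendsto_const[of "E n"]] by simp
    show "\<exists>M. \<forall>m\<ge>M. norm (c m k - c n k) * w k \<le> E m + E n"
      using c_diff that by blast
  qed
  \<comment> \<open>Since \<open>p n\<close> has degree below \<open>n\<close>, its padded
    coefficient \<open>c n n\<close> is 0, and the error at index \<open>n\<close> is
    \<open>a n\<close> itself.\<close>
  have "norm (a n) * w n \<le> E n" if "n \<ge> 1" for n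
    using a_diff[OF that, of n] by (simp add: c_def)
  then have a_le: "norm (a n) \<le> E n / w n" if "n \<ge> 1" for n
    using that w_pos[of n] by (simp add: field_simps)
  have a_growth: "\<forall>\<^sub>F n in sequentially. norm (a n) \<le> (C / real n) powr (real n / \<rho>)"
    using E_growth eventually_ge_at_top[of 1] by eventually_elim (use a_le order_trans in blast)
  have sum_a: "summable (\<lambda>n. norm (a n) * R ^ n)" if "R \<ge> 0" for R
    by (rule summable_supergeometric[OF C \<open>\<rho> > 0\<close> that _ a_growth]) simp
  define F where "F z = (\<Sum>k. a k * z ^ k)" for z
  have F: "(\<lambda>k. a k * z ^ k) sums F z" for z
    unfolding F_def using sum_a[of "norm z"]
    by (intro summable_sums summable_norm_cancel[of "\<lambda>k. a k * z ^ k"]) (simp add: norm_mult norm_power)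
  have FX: "F \<in> X" by (intro entire_in power_series_entire(1)[OF F])

  \<comment> \<open>Convergence in \<open>X\<close> need not imply pointwise convergence, so \<open>f = F\<close> is obtained from the norm alone.\<close>
  have "N (\<lambda>z. f z - F z) \<le> E n + (real n * E n + N (\<lambda>z. F z - (\<Sum>k<n. a k * z ^ k)))" if n: "n \<ge> 1" for n
  proof -
    let ?S = "\<lambda>z. \<Sum>k<n. a k * z ^ k"
    have "N (\<lambda>z. f z - F z) \<le> N (\<lambda>z. f z - p n z) + N (\<lambda>z. p n z - F z)"
      by (intro N_triangle_diff fX pX n FX)
    also have "N (\<lambda>z. p n z - F z) \<le> N (\<lambda>z. p n z - ?S z) + N (\<lambda>z. ?S z - F z)"
      by (intro N_triangle_diff pX n FX poly_in)
    also have "N (\<lambda>z. p n z - ?S z) = N (\<lambda>z. ?S z - p n z)"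
      by (intro N_diff_commute pX n poly_in)
    also have "(\<lambda>z. ?S z - p n z) = (\<lambda>z. \<Sum>k<n. (a k - c n k) * z ^ k)"
      using n by (simp add: p_eq[of n n] sum_subtractf left_diff_distrib)
    also have "N \<dots> \<le> (\<Sum>k<n. norm (a k - c n k) * w k)" by (rule N_poly_le) simp
    also have "\<dots> \<le> (\<Sum>k<n. E n)" using a_diff[OF n] by (intro sum_mono)
    also have "\<dots> = real n * E n" by simp
    also have "N (\<lambda>z. ?S z - F z) = N (\<lambda>z. F z - ?S z)" by (intro N_diff_commute poly_in FX)
    finally show ?thesis using p(2)[OF n] by (simp add: E_def)
  qed
  moreover have "(\<lambda>n. E n + (real n * E n + N (\<lambda>z. F z - (\<Sum>k<n. a k * z ^ k)))) \<longlonglongrightarrow> 0 + (0 + 0)"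
    by (intro tendsto_add E0 nE partial_sums_tendsto[OF F])
  ultimately have "N (\<lambda>z. f z - F z) \<le> 0"
    by (intro LIMSEQ_le_const[of _ 0]) auto
  then have "N (\<lambda>z. f z - F z) = 0" using N_nonneg[OF diff_in[OF fX FX]] by simp
  then have fF: "f z = F z" if "z \<in> udisc" for z
    using that N_zero_iff[OF diff_in[OF fX FX]] by simp

  have "uniform_limit (ball 0 r) p F sequentially" if r: "0 < r" "r < \<mu>" for r
  proof -
    \<comment> \<open>Eventually \<open>w k \<ge> \<nu> ^ k\<close>, so \<open>r ^ k / w k\<close>
      is dominated by a geometric sequence of ratio \<open>r / \<nu> < 1\<close>.\<close>
    obtain \<nu> where \<nu>: "r < \<nu>" "\<nu> < \<mu>" using r(2) dense by blast
    have sum_r: "summable (\<lambda>k. r ^ k / w k)"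
    proof (rule summable_comparison_test_ev)
      show "\<forall>\<^sub>F k in sequentially. norm (r ^ k / w k) \<le> (r / \<nu>) ^ k"
        using w_lower[OF less_trans[OF r(1) \<nu>(1)] \<nu>(2)]
      proof eventually_elim
        case (elim k)
        have "r ^ k / w k \<le> r ^ k / \<nu> ^ k" using elim r \<nu> w_pos[of k] by (intro divide_left_mono) auto
        then show "norm (r ^ k / w k) \<le> (r / \<nu>) ^ k" using w_pos[of k] r by (simp add: power_divide)
      qed
      show "summable (\<lambda>k. (r / \<nu>) ^ k)" using r \<nu> by (intro summable_geometric) auto
    qed
    \<comment> \<open>A bound uniform on the disc: the first summand is the accumulated coefficient
      error, the second the absolute Taylor tail of \<open>F\<close>.\<close>
    define D where "D n = E n * (\<Sum>k. r ^ k / w k) + ((\<Sum>k. norm (a k) * r ^ k) - (\<Sum>k<n. norm (a k) * r ^ k))" for n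
    have sar: "summable (\<lambda>k. norm (a k) * r ^ k)" using sum_a r by simp
    have "D \<longlonglongrightarrow> 0 * (\<Sum>k. r ^ k / w k) + ((\<Sum>k. norm (a k) * r ^ k) - (\<Sum>k. norm (a k) * r ^ k))"
      unfolding D_def by (intro tendsto_intros E0 summable_LIMSEQ sar)
    then have D0: "D \<longlonglongrightarrow> 0" by simp
    have le: "norm (p n z - F z) \<le> D n" if n: "n \<ge> 1" and z: "z \<in> ball 0 r" for n z
    proof -
      have zr: "norm z ^ k \<le> r ^ k" for k using z by (intro power_mono) auto
      have tail: "(\<lambda>k. a (k + n) * z ^ (k + n)) sums (F z - (\<Sum>k<n. a k * z ^ k))"
        by (rule sums_split_initial_segment[OF F])
      have le_k: "norm (a (k + n) * z ^ (k + n)) \<le> norm (a (k + n)) * r ^ (k + n)" for k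
        unfolding norm_mult norm_power by (intro mult_left_mono zr) simp
      have sar': "summable (\<lambda>k. norm (a (k + n)) * r ^ (k + n))"
        using sar by (subst summable_iff_shift[of "\<lambda>k. norm (a k) * r ^ k"])
      have "norm (F z - (\<Sum>k<n. a k * z ^ k)) = norm (\<Sum>k. a (k + n) * z ^ (k + n))"
        using tail by (simp add: sums_iff)
      also have "\<dots> \<le> (\<Sum>k. norm (a (k + n)) * r ^ (k + n))"
        by (rule norm_suminf_le[OF le_k sar'])
      also have "\<dots> = (\<Sum>k. norm (a k) * r ^ k) - (\<Sum>k<n. norm (a k) * r ^ k)"
        using suminf_minus_initial_segment[OF sar] by simp
      finally have 1: "norm (F z - (\<Sum>k<n. a k * z ^ k)) \<le> \<dots>" .
      have "norm (p n z - (\<Sum>k<n. a k * z ^ k)) = norm (\<Sum>k<n. (c n k - a k) * z ^ k)"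
        using n by (simp add: p_eq[of n n] sum_subtractf left_diff_distrib)
      also have "\<dots> \<le> (\<Sum>k<n. E n * (r ^ k / w k))"
      proof (rule sum_norm_le)
        fix k
        have "norm (c n k - a k) \<le> E n / w k"
          using a_diff[OF n, of k] w_pos[of k] by (simp add: field_simps norm_minus_commute)
        then have "norm (c n k - a k) * norm z ^ k \<le> E n / w k * r ^ k"
          using zr[of k] E_nonneg[of n] w_pos[of k] by (intro mult_mono) auto
        then show "norm ((c n k - a k) * z ^ k) \<le> E n * (r ^ k / w k)"
          by (simp add: norm_mult norm_power)
      qed
      also have "\<dots> = E n * (\<Sum>k<n. r ^ k / w k)" by (simp add: sum_distrib_left)
      also have "\<dots> \<le> E n * (\<Sum>k. r ^ k / w k)"
        using r w_pos by (intro mult_left_mono E_nonneg sum_le_suminf sum_r) (auto simp: less_imp_le)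
      finally have 2: "norm (p n z - (\<Sum>k<n. a k * z ^ k)) \<le> \<dots>" .
      show ?thesis
        using norm_triangle_ineq4[of "p n z - (\<Sum>k<n. a k * z ^ k)" "F z - (\<Sum>k<n. a k * z ^ k)"] 1 2
        by (simp add: D_def)
    qed
    show ?thesis
    proof (rule uniform_limitI)
      fix e :: real assume "e > 0"
      from order_tendstoD(2)[OF D0 this] eventually_ge_at_top[of 1]
      show "\<forall>\<^sub>F n in sequentially. \<forall>z\<in>ball 0 r. dist (p n z) (F z) < e"
        by eventually_elim (use le in \<open>force simp: dist_norm intro: le_less_trans\<close>)
    qed
  qed
  with F fF show ?thesis by (rule that)
qed

end

theorem theorem4p3:
  fixes X :: "(complex \<Rightarrow> complex) set" and N :: "(complex \<Rightarrow> complex) \<Rightarrow> real"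
    and f :: "complex \<Rightarrow> complex" and \<mu> \<rho> \<sigma> :: real
  assumes "admissible_space X N"
    and "(\<lambda>n. N (\<lambda>z. z ^ n) powr (1 / real n)) \<longlonglongrightarrow> \<mu>" and "\<mu> > 0"
    and "f \<in> X" and "\<rho> > 0" and "\<sigma> > 0"
  shows "((\<exists>F. entire_order_type F \<rho> \<sigma> \<and> (\<forall>z\<in>udisc. f z = F z)) \<longrightarrow>
            limsup (\<lambda>n. ereal (real n / (exp 1 * \<rho>) *
               (best_approx_err N n f / N (\<lambda>z. z ^ n)) powr (\<rho> / real n))) = ereal \<sigma>)
       \<and> (limsup (\<lambda>n. ereal (real n / (exp 1 * \<rho>) *
               (best_approx_err N n f / N (\<lambda>z. z ^ n)) powr (\<rho> / real n))) = ereal \<sigma> \<longrightarrow>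
          (\<forall>p::nat \<Rightarrow> complex \<Rightarrow> complex.
             (\<forall>n\<ge>1. p n \<in> polys n \<and> N (\<lambda>z. f z - p n z) = best_approx_err N n f) \<longrightarrow>
             (\<exists>F. entire_order_type F \<rho> \<sigma> \<and>
                  (\<forall>r. 0 < r \<and> r < \<mu> \<longrightarrow> uniform_limit (ball 0 r) p F sequentially))))"
proof -
  interpret admissible X N by unfold_locales (fact assms(1))
  note lim = assms(2)[folded w_def]
  \<comment> \<open>Both directions use this equivalence: first for the given entire function, then
    for the limit of the approximants. As that limit agrees with \<open>f\<close> on the disc, its
    order and type follow from the error formula rather than from the mode of convergence.\<close>
  have iff: "entire_order_type F \<rho> \<sigma> \<longleftrightarrow>
      limsup (\<lambda>n. ereal (real n / (exp 1 * \<rho>) * (best_approx_err N n f / w n) powr (\<rho> / real n))) = ereal \<sigma>"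
    if "\<And>z. (\<lambda>k. a k * z ^ k) sums F z" "\<And>z. z \<in> udisc \<Longrightarrow> f z = F z" for a F
    unfolding coeff_limsup_eq_type[OF that(1) assms(5,6)]
    by (rule coeff_limsup_iff_err_limsup[OF that assms(4) lim assms(3,5,6)])
  show ?thesis
    unfolding w_def[symmetric]
  proof (intro conjI impI allI)
    assume "\<exists>F. entire_order_type F \<rho> \<sigma> \<and> (\<forall>z\<in>udisc. f z = F z)"
    then obtain F where F: "entire_order_type F \<rho> \<sigma>" "\<And>z. z \<in> udisc \<Longrightarrow> f z = F z" by blast
    have "(\<lambda>k. (deriv ^^ k) F 0 / fact k * z ^ k) sums F z" for z
      using holomorphic_power_series[of F 0 "norm z + 1" z] F(1)
      by (auto simp: entire_order_type_def intro: holomorphic_on_subset)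
    from iff[OF this F(2)] F(1)
    show "limsup (\<lambda>n. ereal (real n / (exp 1 * \<rho>) * (best_approx_err N n f / w n) powr (\<rho> / real n))) = ereal \<sigma>"
      by simp
  next
    fix p :: "nat \<Rightarrow> complex \<Rightarrow> complex"
    assume err: "limsup (\<lambda>n. ereal (real n / (exp 1 * \<rho>) * (best_approx_err N n f / w n) powr (\<rho> / real n))) = ereal \<sigma>"
      and p: "\<forall>n\<ge>1. p n \<in> polys n \<and> N (\<lambda>z. f z - p n z) = best_approx_err N n f"
    obtain a F where F: "\<And>z. (\<lambda>k. a k * z ^ k) sums F z" "\<And>z. z \<in> udisc \<Longrightarrow> f z = F z"
      and unif: "\<And>r. 0 < r \<Longrightarrow> r < \<mu> \<Longrightarrow> uniform_limit (ball 0 r) p F sequentially"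
    proof (rule best_approx_limit_entire[OF lim assms(3-6) err])
      show "p n \<in> polys n" "N (\<lambda>z. f z - p n z) = best_approx_err N n f" if "n \<ge> 1" for n
        using p that by blast+
    qed (rule that)
    from iff[OF F] err unif
    show "\<exists>F. entire_order_type F \<rho> \<sigma> \<and> (\<forall>r. 0 < r \<and> r < \<mu> \<longrightarrow> uniform_limit (ball 0 r) p F sequentially)"
      by blast
  qed
qed

end
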